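(* Let $\mathcal{G}=(V,D,B)$ be a mixed graph that is a chain graph. Then $\mathcal{G}$ is strictly Gaussian causal (i.e., there exists an acyclic digraph $\mathcal{D}=(U,E)$ with $U\supseteq V$ such that $\mathbf{N}_V(\mathcal{D})=\mathbf{N}(\mathcal{G})$) if and only if the bidirected part $(V,B)$ is decomposable.
   Context: All vertex sets are finite. A mixed graph is a triple $\mathcal{G}=(V,D,B)$ with $D,B\subseteq V\times V$, where $(u,v)\in D$ is a directed edge $u\to v$ and $(u,v)\in B$ is a bidirected edge $u\leftrightarrow v$; $B$ is symmetric, and there are no self-loops, i.e. $(v,v)\notin D\cup B$. A semi-directed cycle is a cycle $(v_1,v_2),(v_2,v_3),\dots,(v_n,v_1)\in D\cup B$ with at least one of these edges in $D$ (directed edges being traversed along their orientation). A chain graph is a mixed graph without semi-directed cycles; in particular $(V,D)$ is acyclic. The bidirected part is $(V,B)$, viewed as an undirected graph; it is decomposable (chordal) if it has no induced cycle of length more than three. Mixed graph model: let $\mathbb{R}^D$ be the set of $V\times V$ matrices $\Lambda=(\lambda_{uv})$ with $\lambda_{uv}=0$ whenever $u\to v\notin D$ (in particular zero diagonal), and let $\mathit{PD}(B)$ be the set of positive definite symmetric $V\times V$ matrices $\Omega=(\omega_{uv})$ with $\omega_{uv}=0$ whenever $u\neq v$ and $u\leftrightarrow v\notin B$. $\mathbf{N}(\mathcal{G})$ is the family of all normal distributions $\mathcal{N}(\mu,\Sigma)$ on $\mathbb{R}^V$ with $\mu\in\mathbb{R}^V$ arbitrary and $\Sigma=(I-\Lambda)^{-T}\Omega(I-\Lambda)^{-1}$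 for some $\Lambda\in\mathbb{R}^D$, $\Omega\in\mathit{PD}(B)$. Digraph model: for an acyclic digraph $\mathcal{D}=(U,E)$, $\mathbf{N}(\mathcal{D})$ is the family of all $\mathcal{N}(\mu,\Sigma)$ on $\mathbb{R}^U$ with $\Sigma=(I-\Lambda)^{-T}\Omega(I-\Lambda)^{-1}$, where $\Lambda\in\mathbb{R}^{E}$ (the $U\times U$ matrices supported on $E$) and $\Omega\in\mathbb{R}^{U\times U}$ is diagonal with positive diagonal entries. For $V\subseteq U$, $\mathbf{N}_V(\mathcal{D})$ is the set of $V$-marginals (on $\mathbb{R}^V$) of distributions in $\mathbf{N}(\mathcal{D})$. *)

theory Defs
  imports "HOL-Probability.Probability" "HOL-Library.Infinite_Typeclass"
begin

section \<open>Mixed graphs\<close>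

definition mixed_graph :: "'a set \<Rightarrow> ('a \<times> 'a) set \<Rightarrow> ('a \<times> 'a) set \<Rightarrow> bool" where
  "mixed_graph V D B \<longleftrightarrow>
     finite V \<and> D \<subseteq> V \<times> V \<and> B \<subseteq> V \<times> V \<and> sym B \<and> (\<forall>v. (v, v) \<notin> D \<union> B)"

text \<open>Repeated vertices are not excluded: a closed walk through an edge of \<open>D\<close> contains
  a cycle on distinct vertices through that edge, so excluding them would give the same
  chain graphs.\<close>

definition semi_directed_cycle :: "('a \<times> 'a) set \<Rightarrow> ('a \<times> 'a) set \<Rightarrow> 'a list \<Rightarrow> bool" where
  "semi_directed_cycle D B vs \<longleftrightarrow>
     (\<forall>i < length vs. (vs ! i, vs ! (Suc i mod length vs)) \<in> D \<union> B) \<and>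
     (\<exists>i < length vs. (vs ! i, vs ! (Suc i mod length vs)) \<in> D)"

definition chain_graph :: "'a set \<Rightarrow> ('a \<times> 'a) set \<Rightarrow> ('a \<times> 'a) set \<Rightarrow> bool" where
  "chain_graph V D B \<longleftrightarrow> mixed_graph V D B \<and> \<not> (\<exists>vs. semi_directed_cycle D B vs)"

text \<open>Here \<open>B\<close> is the adjacency relation of an undirected graph: symmetric and irreflexive.\<close>

definition induced_cycle :: "'a set \<Rightarrow> ('a \<times> 'a) set \<Rightarrow> 'a list \<Rightarrow> bool" where
  "induced_cycle V B vs \<longleftrightarrow>
     3 \<le> length vs \<and> distinct vs \<and> set vs \<subseteq> V \<and>
     (\<forall>i < length vs. \<forall>j < length vs.
        (vs ! i, vs ! j) \<in> B \<longleftrightarrow> j = Suc i mod length vs \<or> i = Suc j mod length vs)"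

definition decomposable :: "'a set \<Rightarrow> ('a \<times> 'a) set \<Rightarrow> bool" where
  "decomposable V B \<longleftrightarrow> \<not> (\<exists>vs. induced_cycle V B vs \<and> length vs > 3)"


section \<open>Matrices indexed by a finite set\<close>

text \<open>A \<open>V \<times> V\<close> matrix is a function \<^typ>\<open>'a \<Rightarrow> 'a \<Rightarrow> real\<close>, and a vector in \<open>\<real>\<^sup>V\<close> that serves
  as a parameter is a function \<^typ>\<open>'a \<Rightarrow> real\<close>; their values outside \<open>V\<close> are irrelevant.\<close>

type_synonym 'a rmat = "'a \<Rightarrow> 'a \<Rightarrow> real"

definition idm :: "'a rmat" where
  "idm = (\<lambda>i j. if i = j then 1 else 0)"

definition transp :: "'a rmat \<Rightarrow> 'a rmat" where
  "transp A = (\<lambda>i j. A j i)"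

definition mmul :: "'a set \<Rightarrow> 'a rmat \<Rightarrow> 'a rmat \<Rightarrow> 'a rmat" where
  "mmul V A A' = (\<lambda>i j. \<Sum>k\<in>V. A i k * A' k j)"

definition mat_eq :: "'a set \<Rightarrow> 'a rmat \<Rightarrow> 'a rmat \<Rightarrow> bool" where
  "mat_eq V A A' \<longleftrightarrow> (\<forall>i\<in>V. \<forall>j\<in>V. A i j = A' i j)"

text \<open>As for \<^const>\<open>matrix_inv\<close>, the inverse is a choice, which on \<open>V \<times> V\<close> is unique if
  \<open>A\<close> is invertible.\<close>

definition minv :: "'a set \<Rightarrow> 'a rmat \<Rightarrow> 'a rmat" where
  "minv V A = (SOME A'. mat_eq V (mmul V A A') idm \<and> mat_eq V (mmul V A' A) idm)"

text \<open>The defining formula of \<^const>\<open>det\<close>, with the index set \<open>V\<close> in place of a finite type.\<close>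

definition mdet :: "'a set \<Rightarrow> 'a rmat \<Rightarrow> real" where
  "mdet V A = (\<Sum>p | p permutes V. of_int (sign p) * (\<Prod>i\<in>V. A i (p i)))"

definition sym_pos_def :: "'a set \<Rightarrow> 'a rmat \<Rightarrow> bool" where
  "sym_pos_def V A \<longleftrightarrow>
     (\<forall>i\<in>V. \<forall>j\<in>V. A i j = A j i) \<and>
     (\<forall>x. (\<exists>i\<in>V. x i \<noteq> 0) \<longrightarrow> (\<Sum>i\<in>V. \<Sum>j\<in>V. x i * A i j * x j) > 0)"

definition supported_on :: "'a set \<Rightarrow> ('a \<times> 'a) set \<Rightarrow> 'a rmat \<Rightarrow> bool" where
  "supported_on V D L \<longleftrightarrow> (\<forall>u\<in>V. \<forall>v\<in>V. (u, v) \<notin> D \<longrightarrow> L u v = 0)"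

definition PD :: "'a set \<Rightarrow> ('a \<times> 'a) set \<Rightarrow> 'a rmat set" where
  "PD V B = {W. sym_pos_def V W \<and>
                (\<forall>u\<in>V. \<forall>v\<in>V. u \<noteq> v \<and> (u, v) \<notin> B \<longrightarrow> W u v = 0)}"

definition pos_diag :: "'a set \<Rightarrow> 'a rmat set" where
  "pos_diag U = {W. (\<forall>u\<in>U. \<forall>v\<in>U. u \<noteq> v \<longrightarrow> W u v = 0) \<and> (\<forall>u\<in>U. W u u > 0)}"

text \<open>\<open>(I - \<Lambda>)\<^sup>-\<^sup>T \<Omega> (I - \<Lambda>)\<^sup>-\<^sup>1\<close>. It is only used for \<open>\<Lambda>\<close> supported on an acyclic
  relation, and then \<open>I - \<Lambda>\<close> is invertible.\<close>

definition sem_cov :: "'a set \<Rightarrow> 'a rmat \<Rightarrow> 'a rmat \<Rightarrow> 'a rmat" where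
  "sem_cov V L W =
     (let M = minv V (\<lambda>i j. idm i j - L i j) in mmul V (mmul V (transp M) W) M)"


section \<open>Gaussian models\<close>

text \<open>\<open>\<real>\<^sup>V\<close> is the product space \<^term>\<open>Pi\<^sub>M V (\<lambda>_. lborel)\<close> of extensional functions.\<close>

definition mvn_density :: "'a set \<Rightarrow> ('a \<Rightarrow> real) \<Rightarrow> 'a rmat \<Rightarrow> ('a \<Rightarrow> real) \<Rightarrow> real" where
  "mvn_density V \<mu> S x =
     exp (- (\<Sum>i\<in>V. \<Sum>j\<in>V. (x i - \<mu> i) * minv V S i j * (x j - \<mu> j)) / 2)
       / sqrt ((2 * pi) ^ card V * mdet V S)"

definition mvn :: "'a set \<Rightarrow> ('a \<Rightarrow> real) \<Rightarrow> 'a rmat \<Rightarrow> ('a \<Rightarrow> real) measure" where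
  "mvn V \<mu> S = density (Pi\<^sub>M V (\<lambda>_. lborel)) (\<lambda>x. ennreal (mvn_density V \<mu> S x))"

definition marginal :: "'a set \<Rightarrow> ('a \<Rightarrow> real) measure \<Rightarrow> ('a \<Rightarrow> real) measure" where
  "marginal V M = distr M (Pi\<^sub>M V (\<lambda>_. lborel)) (\<lambda>x. restrict x V)"

definition mixed_graph_model ::
  "'a set \<Rightarrow> ('a \<times> 'a) set \<Rightarrow> ('a \<times> 'a) set \<Rightarrow> ('a \<Rightarrow> real) measure set" where
  "mixed_graph_model V D B =
     {mvn V \<mu> (sem_cov V L W) | \<mu> L W. supported_on V D L \<and> W \<in> PD V B}"

definition digraph_model :: "'a set \<Rightarrow> ('a \<times> 'a) set \<Rightarrow> ('a \<Rightarrow> real) measure set" where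
  "digraph_model U E =
     {mvn U \<mu> (sem_cov U L W) | \<mu> L W. supported_on U E L \<and> W \<in> pos_diag U}"

definition acyclic_digraph :: "'a set \<Rightarrow> ('a \<times> 'a) set \<Rightarrow> bool" where
  "acyclic_digraph U E \<longleftrightarrow> finite U \<and> E \<subseteq> U \<times> U \<and> acyclic E"

text \<open>The vertex type is infinite, so that \<open>U\<close> can contain arbitrarily many new vertices.\<close>

definition strictly_gaussian_causal ::
  "('a::infinite) set \<Rightarrow> ('a \<times> 'a) set \<Rightarrow> ('a \<times> 'a) set \<Rightarrow> bool" where
  "strictly_gaussian_causal V D B \<longleftrightarrow>
     (\<exists>U E. acyclic_digraph U E \<and> V \<subseteq> U \<and>
            marginal V ` digraph_model U E = mixed_graph_model V D B)"

end

theory Submission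
  imports Defs
begin

text \<open>
  Sufficiency. Eliminating simplicial vertices gives a Cholesky factorization without fill-in. So
  every matrix in \<open>PD(B)\<close> is a small positive multiple of the identity plus a sum of rank one
  matrices supported on cliques, and each rank one matrix is the contribution of one hidden source
  whose children form the clique.

  Necessity. Let \<open>C\<close> be an induced cycle of length at least four in \<open>(V, B)\<close> and \<open>P\<close> the set of its
  parents. In the mixed graph model the conditional covariance matrix of \<open>C\<close> given \<open>P\<close> is
  \<open>\<Omega>\<^sub>C\<^sub>C\<close>. In the digraph model it is, by the Cauchy-Binet formula and up to a positive factor,
  \<open>\<Sum>S. \<omega>\<^sub>S \<tau>\<^sub>S \<tau>\<^sub>S\<^sup>T\<close>, where \<open>S\<close> ranges over sets of errors and \<open>\<omega>\<^sub>S\<close> is the product of their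
  variances. If the models agree, the entries of nonadjacent \<open>a, b\<close> vanish for all variances, so
  \<open>\<tau>\<^sub>S(a) \<tau>\<^sub>S(b) = 0\<close> for every \<open>S\<close>: each \<open>\<tau>\<^sub>S\<close> is supported on an edge of the cycle. Hence twice
  the sum of the absolute values of the entries on the edges is at most the trace of \<open>\<Omega>\<^sub>C\<^sub>C\<close>. This
  fails for the positive definite matrix with diagonal slightly below \<open>2\<close> and edge entries
  \<open>-1, \<dots>, -1, 1\<close>.
\<close>

section \<open>Determinants over a finite index set\<close>

text \<open>Equality of the models enters in both directions. One inclusion realizes the critical
  law of the mixed model in the digraph, which fixes a coefficient matrix \<open>L\<close>; the
  other is applied with this \<open>L\<close> and arbitrary error variances. The hidden digraph is
  arbitrary, so what can be exploited is the polynomial dependence on the variances. The coefficient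
  belonging to a set of errors is a single product of two minors, which leaves no room for
  cancellation between hidden paths. Conditioning on the parents isolates the error covariance: in a
  chain graph the errors of \<open>C\<close> are independent of the parents, because no walk returns
  from \<open>C\<close> to them. The diagonal value \<open>2\<close> is critical, since it would
  give equality in the trace bound. The sum of the squares of \<open>x_k - x_{k+1}\<close> around
  the cycle is only semidefinite; a single change of sign makes it definite, and definiteness leaves
  room to lower the diagonal. In the converse direction the multiple of the identity is there
  because every vertex of \<open>V\<close> keeps an error of its own with positive variance.\<close>

lemma mat_eqD: "mat_eq V A B \<Longrightarrow> i \<in> V \<Longrightarrow> j \<in> V \<Longrightarrow> A i j = B i j"
  by (simp add: mat_eq_def)

lemma mdet_cong:
  assumes "mat_eq V A B"
  shows "mdet V A = mdet V B"
proof -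
  have "(\<Prod>i\<in>V. A i (p i)) = (\<Prod>i\<in>V. B i (p i))" if "p permutes V" for p
    using assms that by (intro prod.cong) (auto simp: mat_eq_def permutes_in_image)
  then show ?thesis
    unfolding mdet_def by (intro sum.cong) auto
qed

lemma mdet_empty [simp]: "mdet {} A = 1"
  by (simp add: mdet_def)

lemma mdet_permute_rows:
  assumes V: "finite V" and \<pi>: "\<pi> permutes V"
  shows "mdet V (\<lambda>i j. A (\<pi> i) j) = of_int (sign \<pi>) * mdet V A"
proof -
  have P: "permutation \<pi>"
    using \<pi> V permutation_permutes by blast
  have "mdet V (\<lambda>i j. A (\<pi> i) j) = (\<Sum>p | p permutes V. of_int (sign (p \<circ> \<pi>)) * (\<Prod>i\<in>V. A (\<pi> i) ((p \<circ> \<pi>) i)))"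
    unfolding mdet_def by (rule sum_permutations_compose_right[OF \<pi>])
  also have "\<dots> = (\<Sum>p | p permutes V. of_int (sign \<pi>) * (of_int (sign p) * (\<Prod>i\<in>V. A i (p i))))"
  proof (intro sum.cong refl)
    fix p assume "p \<in> {p. p permutes V}"
    then have p: "p permutes V" by simp
    then have "permutation p" using V permutation_permutes by blast
    then have "sign (p \<circ> \<pi>) = sign p * sign \<pi>" using P by (rule sign_compose)
    moreover have "(\<Prod>i\<in>V. A (\<pi> i) ((p \<circ> \<pi>) i)) = (\<Prod>i\<in>V. A i (p i))"
      using prod.permute[OF \<pi>, of "\<lambda>i. A i (p i)"] by (simp add: o_def)
    ultimately show "of_int (sign (p \<circ> \<pi>)) * (\<Prod>i\<in>V. A (\<pi> i) ((p \<circ> \<pi>) i)) =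
        of_int (sign \<pi>) * (of_int (sign p) * (\<Prod>i\<in>V. A i (p i)))"
      by simp
  qed
  finally show ?thesis
    by (simp add: mdet_def sum_distrib_left)
qed

lemma mdet_identical_rows:
  assumes V: "finite V" and "a \<in> V" "b \<in> V" "a \<noteq> b" "\<And>j. j \<in> V \<Longrightarrow> A a j = A b j"
  shows "mdet V A = 0"
proof -
  have \<pi>: "Transposition.transpose a b permutes V"
    using assms by (simp add: permutes_swap_id)
  have "mat_eq V (\<lambda>i j. A (Transposition.transpose a b i) j) A"
    using assms(5) by (auto simp: mat_eq_def Transposition.transpose_def)
  then have "mdet V A = mdet V (\<lambda>i j. A (Transposition.transpose a b i) j)"
    by (rule mdet_cong[symmetric])
  also have "\<dots> = - mdet V A"
    using mdet_permute_rows[OF V \<pi>, of A] \<open>a \<noteq> b\<close> by (simp add: sign_swap_id)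
  finally show ?thesis by simp
qed

lemma mdet_row_sum:
  assumes V: "finite V" and z: "z \<in> V"
  shows "mdet V (A(z := (\<lambda>j. \<Sum>k\<in>K. c k * R k j))) = (\<Sum>k\<in>K. c k * mdet V (A(z := R k)))"
proof -
  have *: "(\<Prod>i\<in>V. (A(z := r)) i (p i)) = r (p z) * (\<Prod>i\<in>V - {z}. A i (p i))" for r p
  proof -
    have "(\<Prod>i\<in>V - {z}. (A(z := r)) i (p i)) = (\<Prod>i\<in>V - {z}. A i (p i))"
      by (intro prod.cong) auto
    then show ?thesis
      using V z by (simp add: prod.remove)
  qed
  show ?thesis
    unfolding mdet_def * sum_distrib_left sum_distrib_right
    by (subst sum.swap) (simp add: algebra_simps)
qed

text \<open>By multilinearity only the summand \<open>k = z\<close> survives, the others having two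
  equal rows. With \<open>c z = 1\<close> this is row elimination; with a row of the inverse as
  \<open>c\<close> it gives Cramer's rule.\<close>

lemma mdet_row_combination:
  assumes V: "finite V" and z: "z \<in> V"
  shows "mdet V (A(z := (\<lambda>j. \<Sum>k\<in>V. c k * A k j))) = c z * mdet V A"
proof -
  have "mdet V (A(z := A k)) = 0" if "k \<in> V" "k \<noteq> z" for k
    using V z that by (intro mdet_identical_rows[of V z k]) auto
  then have "(\<Sum>k\<in>V. c k * mdet V (A(z := A k))) = (\<Sum>k\<in>V. if k = z then c z * mdet V A else 0)"
    by (intro sum.cong) auto
  then show ?thesis
    using V z by (simp add: mdet_row_sum)
qed

text \<open>Laplace expansion along row \<open>z\<close>: a permutation that moves \<open>z\<close>
  picks a vanishing entry, and those that fix \<open>z\<close> are the permutations of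
  \<open>P\<close>.\<close>

lemma mdet_insert_row_zero:
  assumes P: "finite P" and z: "z \<notin> P" and 0: "\<And>j. j \<in> P \<Longrightarrow> A z j = 0"
  shows "mdet (insert z P) A = A z z * mdet P A"
proof -
  let ?f = "\<lambda>p. of_int (sign p) * (\<Prod>i\<in>insert z P. A i (p i))"
  have "?f p = 0" if "p permutes insert z P" "\<not> p permutes P" for p
  proof -
    have "p z \<noteq> z"
      using that z permutes_superset[of p "insert z P" P] by auto
    moreover have "p z \<in> insert z P"
      using that(1) permutes_in_image[of p "insert z P" z] by simp
    ultimately have "A z (p z) = 0" using 0 by auto
    then show ?thesis using P z by simp
  qed
  then have "mdet (insert z P) A = (\<Sum>p | p permutes P. ?f p)"
    unfolding mdet_def using P
    by (intro sum.mono_neutral_right) (auto simp: finite_permutations intro: permutes_subset)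
  also have "\<dots> = A z z * mdet P A"
    unfolding mdet_def sum_distrib_left using P z
    by (intro sum.cong) (auto simp: permutes_not_in)
  finally show ?thesis .
qed

lemma mdet_columns:
  assumes V: "finite V"
  shows "mdet V A = (\<Sum>\<pi> | \<pi> permutes V. of_int (sign \<pi>) * (\<Prod>i\<in>V. A (\<pi> i) i))"
proof -
  have "mdet V A = (\<Sum>p | p permutes V. of_int (sign (inv p)) * (\<Prod>i\<in>V. A i (inv p i)))"
    unfolding mdet_def by (rule sum_permutations_inverse)
  also have "\<dots> = (\<Sum>p | p permutes V. of_int (sign p) * (\<Prod>i\<in>V. A (p i) i))"
  proof (intro sum.cong refl)
    fix p assume "p \<in> {p. p permutes V}"
    then have p: "p permutes V" by simp
    then have "permutation p" using V permutation_permutes by blast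
    then have "sign (inv p) = sign p" by (rule sign_inverse)
    moreover have "(\<Prod>i\<in>V. A i (inv p i)) = (\<Prod>i\<in>V. A (p i) i)"
      using prod.permute[OF p, of "\<lambda>i. A i (inv p i)"] p by (simp add: o_def permutes_inverses)
    ultimately show "of_int (sign (inv p)) * (\<Prod>i\<in>V. A i (inv p i)) = of_int (sign p) * (\<Prod>i\<in>V. A (p i) i)"
      by simp
  qed
  finally show ?thesis .
qed

text \<open>Summing over all functions \<open>f\<close> rather than over subsets of \<open>U\<close> counts every minor
  \<open>fact (card Q)\<close> times, and non-injective \<open>f\<close> contribute nothing.\<close>

lemma Cauchy_Binet:
  assumes Q: "finite Q" and U: "finite U"
  shows "fact (card Q) * mdet Q (\<lambda>i j. \<Sum>u\<in>U. w u * X u i * Y u j) =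
    (\<Sum>f\<in>Q \<rightarrow>\<^sub>E U. (\<Prod>i\<in>Q. w (f i)) * mdet Q (\<lambda>i j. X (f i) j) * mdet Q (\<lambda>i j. Y (f i) j))"
proof -
  define F where "F = Q \<rightarrow>\<^sub>E U"
  define G where "G f = (\<Prod>i\<in>Q. w (f i)) * mdet Q (\<lambda>i j. Y (f i) j)" for f :: "_ \<Rightarrow> _"
  define Z where "Z = mdet Q (\<lambda>i j. \<Sum>u\<in>U. w u * X u i * Y u j)"
  have F: "finite F" unfolding F_def using Q U by (simp add: finite_PiE)
  have Z: "Z = (\<Sum>f\<in>F. (\<Prod>i\<in>Q. X (f i) i) * G f)"
  proof -
    have "Z = (\<Sum>p | p permutes Q. of_int (sign p) * (\<Sum>f\<in>F. \<Prod>i\<in>Q. w (f i) * X (f i) i * Y (f i) (p i)))"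
      unfolding Z_def mdet_def F_def using Q U by (simp add: prod_sum_PiE)
    also have "\<dots> = (\<Sum>f\<in>F. \<Sum>p | p permutes Q. of_int (sign p) * (\<Prod>i\<in>Q. w (f i) * X (f i) i * Y (f i) (p i)))"
      unfolding sum_distrib_left by (rule sum.swap)
    also have "\<dots> = (\<Sum>f\<in>F. (\<Prod>i\<in>Q. X (f i) i) * G f)"
      unfolding G_def mdet_def sum_distrib_left by (intro sum.cong refl) (simp add: prod.distrib)
    finally show ?thesis .
  qed
  \<comment> \<open>Replacing \<open>f\<close> by \<open>f \<circ> \<pi>\<close> only costs a sign
    in the \<open>Y\<close> minor. Averaging over all \<open>\<pi>\<close> then turns the single
    product of \<open>X\<close> entries into a determinant.\<close>
  have perm: "Z = (\<Sum>f\<in>F. (of_int (sign \<pi>) * (\<Prod>i\<in>Q. X (f (\<pi> i)) i)) * G f)" if \<pi>: "\<pi> permutes Q" for \<pi>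
  proof -
    have io: "inv \<pi> permutes Q" using \<pi> by (rule permutes_inv)
    have "bij_betw (\<lambda>f. f \<circ> \<pi>) F F"
    proof (intro bij_betwI[where g = "\<lambda>f. f \<circ> inv \<pi>"])
      show "(\<lambda>f. f \<circ> \<pi>) \<in> F \<rightarrow> F"
        using \<pi> by (auto simp: F_def PiE_def extensional_def permutes_in_image)
      show "(\<lambda>f. f \<circ> inv \<pi>) \<in> F \<rightarrow> F"
        using io by (auto simp: F_def PiE_def extensional_def permutes_in_image)
    qed (use \<pi> in \<open>auto simp: fun_eq_iff permutes_inverses\<close>)
    then have "Z = (\<Sum>f\<in>F. (\<Prod>i\<in>Q. X ((f \<circ> \<pi>) i) i) * G (f \<circ> \<pi>))"
      unfolding Z by (rule sum.reindex_bij_betw[symmetric])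
    also have "(\<lambda>f. G (f \<circ> \<pi>)) = (\<lambda>f. of_int (sign \<pi>) * G f)"
    proof
      fix f
      have "(\<Prod>i\<in>Q. w ((f \<circ> \<pi>) i)) = (\<Prod>i\<in>Q. w (f i))"
        using prod.permute[OF \<pi>, of "\<lambda>i. w (f i)"] by (simp add: o_def)
      then show "G (f \<circ> \<pi>) = of_int (sign \<pi>) * G f"
        using mdet_permute_rows[OF Q \<pi>, of "\<lambda>i j. Y (f i) j"] by (simp add: G_def)
    qed
    finally show ?thesis by (simp add: mult_ac)
  qed
  have "fact (card Q) * Z = (\<Sum>\<pi> | \<pi> permutes Q. Z)"
    using card_permutations[OF refl Q] by simp
  also have "\<dots> = (\<Sum>\<pi> | \<pi> permutes Q. \<Sum>f\<in>F. (of_int (sign \<pi>) * (\<Prod>i\<in>Q. X (f (\<pi> i)) i)) * G f)"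
    using perm by (intro sum.cong) auto
  also have "\<dots> = (\<Sum>f\<in>F. mdet Q (\<lambda>i j. X (f i) j) * G f)"
    unfolding mdet_columns[OF Q, of "\<lambda>i j. X (_ i) j"] sum_distrib_right by (rule sum.swap)
  finally show ?thesis
    by (simp add: Z_def F_def G_def mult_ac)
qed

section \<open>Inverses and positive definite matrices\<close>

lemma mat_eq_refl [simp]: "mat_eq V A A"
  by (simp add: mat_eq_def)

lemma mat_eq_sym: "mat_eq V A B \<Longrightarrow> mat_eq V B A"
  by (simp add: mat_eq_def)

lemma mat_eq_trans: "mat_eq V A B \<Longrightarrow> mat_eq V B C \<Longrightarrow> mat_eq V A C"
  by (simp add: mat_eq_def)

lemma mat_eq_mmul: "mat_eq V A A' \<Longrightarrow> mat_eq V B B' \<Longrightarrow> mat_eq V (mmul V A B) (mmul V A' B')"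
  by (simp add: mat_eq_def mmul_def)

lemma mmul_assoc: "mmul V (mmul V A B) C = mmul V A (mmul V B C)"
proof (intro ext)
  fix i j
  have "(\<Sum>l\<in>V. (\<Sum>k\<in>V. A i k * B k l) * C l j) = (\<Sum>l\<in>V. \<Sum>k\<in>V. A i k * (B k l * C l j))"
    by (simp add: sum_distrib_right mult.assoc)
  also have "\<dots> = (\<Sum>k\<in>V. A i k * (\<Sum>l\<in>V. B k l * C l j))"
    unfolding sum_distrib_left by (rule sum.swap)
  finally show "mmul V (mmul V A B) C i j = mmul V A (mmul V B C) i j"
    by (simp add: mmul_def)
qed

lemma transp_mmul: "transp (mmul V A B) = mmul V (transp B) (transp A)"
  by (simp add: transp_def mmul_def mult.commute)

lemma transp_transp [simp]: "transp (transp A) = A"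
  by (simp add: transp_def)

lemma transp_idm [simp]: "transp idm = idm"
  by (auto simp: transp_def idm_def fun_eq_iff)

lemma mat_eq_transp: "mat_eq V A B \<Longrightarrow> mat_eq V (transp A) (transp B)"
  by (simp add: mat_eq_def transp_def)

lemma mmul_idm_left: "finite V \<Longrightarrow> mat_eq V (mmul V idm A) A"
  by (simp add: mat_eq_def mmul_def idm_def if_distrib if_distribR cong: if_cong)

lemma mmul_idm_right: "finite V \<Longrightarrow> mat_eq V (mmul V A idm) A"
  by (simp add: mat_eq_def mmul_def idm_def if_distrib if_distribR cong: if_cong)

text \<open>\<open>minv\<close> is a choice, which says something only once some inverse is known to
  exist. Later lemmas therefore speak of an arbitrary inverse \<open>K\<close>.\<close>

definition is_minv :: "'a set \<Rightarrow> 'a rmat \<Rightarrow> 'a rmat \<Rightarrow> bool" where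
  "is_minv V A K \<longleftrightarrow> mat_eq V (mmul V A K) idm \<and> mat_eq V (mmul V K A) idm"

lemma left_inverse_eq_right_inverse:
  assumes V: "finite V" and N: "mat_eq V (mmul V N A) idm" and K: "mat_eq V (mmul V A K) idm"
  shows "mat_eq V N K"
proof -
  have "mat_eq V N (mmul V N (mmul V A K))"
    using mat_eq_mmul[OF mat_eq_refl K, of N] mmul_idm_right[OF V, of N] by (meson mat_eq_sym mat_eq_trans)
  moreover have "mat_eq V (mmul V (mmul V N A) K) K"
    using mat_eq_mmul[OF N mat_eq_refl, of K] mmul_idm_left[OF V, of K] by (meson mat_eq_trans)
  ultimately show ?thesis by (metis mat_eq_trans mmul_assoc)
qed

lemma is_minvI:
  assumes V: "finite V" and "mat_eq V (mmul V N A) idm" "mat_eq V (mmul V A K) idm"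
  shows "is_minv V A K"
proof -
  have "mat_eq V K N" using left_inverse_eq_right_inverse[OF assms] by (rule mat_eq_sym)
  then have "mat_eq V (mmul V K A) (mmul V N A)" by (intro mat_eq_mmul mat_eq_refl)
  then show ?thesis unfolding is_minv_def using assms by (blast intro: mat_eq_trans)
qed

lemma is_minv_minv: "is_minv V A K \<Longrightarrow> is_minv V A (minv V A)"
  unfolding is_minv_def minv_def
  by (rule someI[where P = "\<lambda>A'. mat_eq V (mmul V A A') idm \<and> mat_eq V (mmul V A' A) idm"])

lemma minv_cong:
  assumes "mat_eq V A B"
  shows "minv V A = minv V B"
proof -
  have "mat_eq V (mmul V A K) idm \<longleftrightarrow> mat_eq V (mmul V B K) idm"
    "mat_eq V (mmul V K A) idm \<longleftrightarrow> mat_eq V (mmul V K B) idm" for K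
    using mat_eq_mmul[OF assms mat_eq_refl, of K] mat_eq_mmul[OF mat_eq_refl assms, of K]
    by (meson mat_eq_sym mat_eq_trans)+
  then show ?thesis unfolding minv_def by simp
qed

lemma is_minv_sum:
  assumes "is_minv V A K" "i \<in> V" "j \<in> V"
  shows "(\<Sum>k\<in>V. A i k * K k j) = (if i = j then 1 else 0)"
    "(\<Sum>k\<in>V. K i k * A k j) = (if i = j then 1 else 0)"
  using assms by (auto simp: is_minv_def mat_eq_def mmul_def idm_def)

lemma is_minv_symmetric:
  assumes V: "finite V" and A: "is_minv V A K" and sym: "\<And>i j. i \<in> V \<Longrightarrow> j \<in> V \<Longrightarrow> A i j = A j i"
    and ij: "i \<in> V" "j \<in> V"
  shows "K i j = K j i"
proof -
  have AT: "mat_eq V (transp A) A" using sym by (auto simp: mat_eq_def transp_def)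
  have "mat_eq V (mmul V (transp K) (transp A)) idm"
    using A mat_eq_transp[of V "mmul V A K" idm] by (simp add: is_minv_def transp_mmul)
  then have "mat_eq V (mmul V (transp K) A) idm"
    using mat_eq_mmul[OF mat_eq_refl AT, of "transp K"] by (meson mat_eq_sym mat_eq_trans)
  then have "mat_eq V (transp K) K"
    using A V by (auto simp: is_minv_def intro: left_inverse_eq_right_inverse)
  then show ?thesis using ij by (auto simp: mat_eq_def transp_def)
qed

section \<open>Bilinear forms and positive definiteness\<close>

definition bil :: "'a set \<Rightarrow> 'a rmat \<Rightarrow> ('a \<Rightarrow> real) \<Rightarrow> ('a \<Rightarrow> real) \<Rightarrow> real" where
  "bil V A x y = (\<Sum>i\<in>V. \<Sum>j\<in>V. x i * A i j * y j)"

lemma bil_alt: "bil V A x y = (\<Sum>i\<in>V. x i * (\<Sum>j\<in>V. A i j * y j))"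
  by (simp add: bil_def sum_distrib_left mult.assoc)

lemma bil_alt': "bil V A x y = (\<Sum>j\<in>V. (\<Sum>i\<in>V. x i * A i j) * y j)"
  unfolding bil_def sum_distrib_right by (rule sum.swap)

lemma bil_cong:
  assumes "mat_eq V A B" "\<And>i. i \<in> V \<Longrightarrow> x i = x' i" "\<And>i. i \<in> V \<Longrightarrow> y i = y' i"
  shows "bil V A x y = bil V B x' y'"
  unfolding bil_def using assms by (intro sum.cong) (auto simp: mat_eq_def)

lemma bil_add_left: "bil V A (\<lambda>i. x i + y i) z = bil V A x z + bil V A y z"
  by (simp add: bil_alt algebra_simps sum.distrib)

lemma bil_add_right: "bil V A z (\<lambda>i. x i + y i) = bil V A z x + bil V A z y"
  by (simp add: bil_alt algebra_simps sum.distrib)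

lemma bil_scale_left: "bil V A (\<lambda>i. c * x i) z = c * bil V A x z"
  by (simp add: bil_alt algebra_simps sum_distrib_left)

lemma bil_scale_right: "bil V A z (\<lambda>i. c * x i) = c * bil V A z x"
  by (simp add: bil_alt algebra_simps sum_distrib_left)

lemma bil_commute:
  assumes "\<And>i j. i \<in> V \<Longrightarrow> j \<in> V \<Longrightarrow> A i j = A j i"
  shows "bil V A x y = bil V A y x"
  unfolding bil_def using assms by (subst sum.swap) (simp add: mult_ac)

lemma bil_indicator:
  assumes V: "finite V" "i \<in> V" "j \<in> V"
  shows "bil V A (\<lambda>k. if k = i then 1 else 0) (\<lambda>k. if k = j then 1 else 0) = A i j"
  using V by (simp add: bil_alt if_distrib if_distribR cong: if_cong)

lemma bil_insert:
  assumes "finite V" "u \<notin> V"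
  shows "bil (insert u V) A y y =
    A u u * (y u)\<^sup>2 + y u * (\<Sum>k\<in>V. A u k * y k) + (\<Sum>k\<in>V. y k * A k u) * y u + bil V A y y"
proof -
  have "bil (insert u V) A y y = y u * (A u u * y u + (\<Sum>k\<in>V. A u k * y k)) +
      (\<Sum>i\<in>V. y i * (A i u * y u + (\<Sum>j\<in>V. A i j * y j)))"
    using assms by (simp add: bil_alt)
  also have "(\<Sum>i\<in>V. y i * (A i u * y u + (\<Sum>j\<in>V. A i j * y j))) = (\<Sum>i\<in>V. y i * A i u) * y u + bil V A y y"
    by (simp add: bil_alt algebra_simps sum.distrib sum_distrib_left)
  finally show ?thesis by (simp add: power2_eq_square algebra_simps)
qed

lemma sym_pos_def_bil:
  "sym_pos_def V A \<longleftrightarrow> (\<forall>i\<in>V. \<forall>j\<in>V. A i j = A j i) \<and> (\<forall>x. (\<exists>i\<in>V. x i \<noteq> 0) \<longrightarrow> bil V A x x > 0)"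
  by (simp add: sym_pos_def_def bil_def)

lemma sym_pos_def_sym: "sym_pos_def V A \<Longrightarrow> i \<in> V \<Longrightarrow> j \<in> V \<Longrightarrow> A i j = A j i"
  by (simp add: sym_pos_def_def)

lemma sym_pos_def_nonneg:
  assumes "sym_pos_def V A"
  shows "bil V A x x \<ge> 0"
proof (cases "\<exists>i\<in>V. x i \<noteq> 0")
  case True
  then show ?thesis using assms unfolding sym_pos_def_bil by (auto intro: less_imp_le)
next
  case False
  then show ?thesis by (simp add: bil_def)
qed

lemma sym_pos_def_subset:
  assumes U: "finite U" and V: "V \<subseteq> U" and S: "sym_pos_def U S"
  shows "sym_pos_def V S"
  unfolding sym_pos_def_bil
proof (intro conjI allI impI ballI)
  fix i j assume "i \<in> V" "j \<in> V" then show "S i j = S j i"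
    using V by (intro sym_pos_def_sym[OF S]) auto
next
  fix x assume ex: "\<exists>i\<in>V. x i \<noteq> (0::real)"
  define y where "y i = (if i \<in> V then x i else 0)" for i
  have "bil U S y y = (\<Sum>i\<in>V. y i * (\<Sum>j\<in>U. S i j * y j))"
    unfolding bil_alt using U V by (intro sum.mono_neutral_right) (auto simp: y_def)
  also have "(\<lambda>i. \<Sum>j\<in>U. S i j * y j) = (\<lambda>i. \<Sum>j\<in>V. S i j * y j)"
    using U V by (intro ext sum.mono_neutral_right) (auto simp: y_def)
  also have "(\<Sum>i\<in>V. y i * (\<Sum>j\<in>V. S i j * y j)) = bil V S x x"
    unfolding bil_alt by (simp add: y_def)
  finally have "bil U S y y = bil V S x x" .
  moreover have "bil U S y y > 0"
  proof -
    have "\<exists>i\<in>U. y i \<noteq> 0" using ex V by (auto simp: y_def)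
    then show ?thesis using S unfolding sym_pos_def_bil by blast
  qed
  ultimately show "bil V S x x > 0" by simp
qed

text \<open>Bordering: solving on \<open>V\<close> for the column \<open>u\<close> reduces the
  larger system to one scalar equation, whose pivot \<open>s\<close> is a Schur complement.\<close>

lemma sym_pos_def_solve:
  assumes "finite V" "sym_pos_def V S"
  shows "\<exists>x. \<forall>i\<in>V. (\<Sum>k\<in>V. S i k * x k) = y i"
  using assms
proof (induction V arbitrary: y rule: finite_induct)
  case (insert u V)
  have PD: "sym_pos_def V S"
    using insert by (intro sym_pos_def_subset[OF _ _ insert.prems]) auto
  obtain g where g: "\<And>i. i \<in> V \<Longrightarrow> (\<Sum>k\<in>V. S i k * g k) = S i u"
    using insert.IH[OF PD, of "\<lambda>i. S i u"] by auto
  obtain p where p: "\<And>i. i \<in> V \<Longrightarrow> (\<Sum>k\<in>V. S i k * p k) = y i"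
    using insert.IH[OF PD, of y] by auto
  define s where "s = S u u - (\<Sum>k\<in>V. S u k * g k)"
  \<comment> \<open>\<open>S z\<close> is \<open>s\<close> times the unit vector of
    \<open>u\<close>, so \<open>s\<close> is the value of the quadratic form at \<open>z\<close> and
    hence positive.\<close>
  define z where "z i = (if i = u then 1 else - g i)" for i
  have zV: "(\<Sum>k\<in>V. a k * z k) = - (\<Sum>k\<in>V. a k * g k)" for a
    unfolding sum_negf[symmetric] using insert.hyps by (intro sum.cong) (auto simp: z_def)
  have "(\<Sum>k\<in>insert u V. S i k * z k) = (if i = u then s else 0)" if "i \<in> insert u V" for i
    using that insert.hyps g by (auto simp: zV s_def) (auto simp: z_def)
  then have "bil (insert u V) S z z = (\<Sum>i\<in>insert u V. z i * (if i = u then s else 0))"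
    unfolding bil_alt by (intro sum.cong) auto
  also have "\<dots> = s" using insert.hyps by (simp add: z_def if_distrib cong: if_cong)
  finally have "bil (insert u V) S z z = s" .
  moreover have "bil (insert u V) S z z > 0"
    using insert.prems unfolding sym_pos_def_bil by (auto simp: z_def)
  ultimately have s: "s > 0" by simp
  define t where "t = (y u - (\<Sum>k\<in>V. S u k * p k)) / s"
  define x where "x i = (if i = u then t else p i - t * g i)" for i
  have xV: "(\<Sum>k\<in>V. a k * x k) = (\<Sum>k\<in>V. a k * p k) - t * (\<Sum>k\<in>V. a k * g k)" for a
  proof -
    have "(\<Sum>k\<in>V. a k * x k) = (\<Sum>k\<in>V. a k * p k - t * (a k * g k))"
      using insert.hyps by (intro sum.cong) (auto simp: x_def algebra_simps)
    then show ?thesis by (simp add: sum_subtractf sum_distrib_left)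
  qed
  have "t * s = y u - (\<Sum>k\<in>V. S u k * p k)" using s by (simp add: t_def)
  then have "(\<Sum>k\<in>insert u V. S i k * x k) = y i" if "i \<in> insert u V" for i
    using that insert.hyps g p by (auto simp: xV) (auto simp: x_def s_def algebra_simps)
  then show ?case by blast
qed auto

lemma sym_pos_def_invertible:
  assumes V: "finite V" and S: "sym_pos_def V S"
  shows "is_minv V S (minv V S)"
proof -
  have "\<exists>x. \<forall>i\<in>V. (\<Sum>k\<in>V. S i k * x k) = (if i = j then 1 else 0)" for j
    by (rule sym_pos_def_solve[OF assms])
  then obtain K where K: "\<And>i j. i \<in> V \<Longrightarrow> (\<Sum>k\<in>V. S i k * K j k) = (if i = j then 1 else 0)"
    by metis
  have SK: "mat_eq V (mmul V S (transp K)) idm"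
    using K by (simp add: mat_eq_def mmul_def idm_def transp_def)
  have ST: "mat_eq V S (transp S)" using S by (auto simp: mat_eq_def transp_def sym_pos_def_def)
  have "mat_eq V (mmul V K (transp S)) idm"
    using mat_eq_transp[OF SK] by (simp add: transp_mmul)
  then have "mat_eq V (mmul V K S) idm"
    using mat_eq_mmul[OF mat_eq_refl ST, of K] by (meson mat_eq_trans)
  from is_minvI[OF V this SK] show ?thesis by (rule is_minv_minv)
qed

text \<open>Column \<open>u\<close> of the inverse represents evaluation at \<open>u\<close> in the
  form of \<open>S\<close>.\<close>

lemma bil_minv_col:
  assumes V: "finite V" and S: "is_minv V S K" and u: "u \<in> V"
  shows "bil V S x (\<lambda>k. K k u) = x u"
proof -
  have "bil V S x (\<lambda>k. K k u) = (\<Sum>i\<in>V. x i * (if i = u then 1 else 0))"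
    unfolding bil_alt using is_minv_sum(1)[OF S _ u] by (intro sum.cong) auto
  then show ?thesis using V u by (simp add: if_distrib cong: if_cong)
qed

lemma sym_pos_def_inverse_diag_pos:
  assumes V: "finite V" and S: "sym_pos_def V S" and u: "u \<in> V" and K: "is_minv V S K"
  shows "K u u > 0"
proof -
  have "\<exists>k\<in>V. K k u \<noteq> 0"
  proof (rule ccontr)
    assume "\<not> ?thesis"
    then show False using is_minv_sum(1)[OF K u u] by simp
  qed
  then have "bil V S (\<lambda>k. K k u) (\<lambda>k. K k u) > 0"
    using S unfolding sym_pos_def_bil by auto
  then show ?thesis using bil_minv_col[OF V K u] by simp
qed

text \<open>Cauchy-Schwarz in the inner product of \<open>S\<close> for \<open>x\<close> and column
  \<open>u\<close> of \<open>K\<close>: their product is \<open>x u\<close>, and the column has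
  squared length \<open>K u u\<close>.\<close>

lemma square_le_inverse_diag_bil:
  assumes V: "finite V" and S: "sym_pos_def V S" and u: "u \<in> V" and K: "is_minv V S K"
  shows "(x u)\<^sup>2 \<le> K u u * bil V S x x"
proof -
  define t where "t = x u / K u u"
  let ?k = "\<lambda>i. K i u" and ?y = "\<lambda>i. x i + (- t) * K i u"
  have K0: "K u u > 0" using sym_pos_def_inverse_diag_pos[OF assms] .
  have "0 \<le> bil V S ?y ?y"
    by (rule sym_pos_def_nonneg[OF S])
  also have "bil V S ?y ?y = bil V S x x - 2 * t * x u + t\<^sup>2 * K u u"
    using bil_commute[of V S ?k x] sym_pos_def_sym[OF S] bil_minv_col[OF V K u]
    unfolding bil_add_left bil_add_right bil_scale_left bil_scale_right
    by (simp add: power2_eq_square algebra_simps)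
  also have "\<dots> = bil V S x x - (x u)\<^sup>2 / K u u"
    using K0 by (simp add: t_def power2_eq_square)
  finally show ?thesis using K0 by (simp add: field_simps)
qed

text \<open>Takes the place of the smallest eigenvalue, without compactness: the bounds for the
  single coordinates add up to the trace \<open>c\<close> of the inverse. Passing to
  \<open>c + 1\<close> makes the inequality strict.\<close>

lemma sym_pos_def_lower_bound:
  assumes V: "finite V" and S: "sym_pos_def V S"
  obtains e where "e > 0" "\<And>x. (\<exists>i\<in>V. x i \<noteq> 0) \<Longrightarrow> bil V S x x > e * (\<Sum>i\<in>V. (x i)\<^sup>2)"
proof -
  define K where "K = minv V S"
  have K: "is_minv V S K" unfolding K_def by (rule sym_pos_def_invertible[OF assms])
  define c where "c = (\<Sum>i\<in>V. K i i)"
  have c: "c \<ge> 0" unfolding c_def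
    using sym_pos_def_inverse_diag_pos[OF V S _ K] by (intro sum_nonneg) (auto intro: less_imp_le)
  show thesis
  proof (rule that[of "1 / (c + 1)"])
    show "1 / (c + 1) > 0" using c by simp
    fix x assume "\<exists>i\<in>V. x i \<noteq> (0::real)"
    then have pos: "bil V S x x > 0" using S unfolding sym_pos_def_bil by auto
    have "(\<Sum>i\<in>V. (x i)\<^sup>2) \<le> (\<Sum>i\<in>V. K i i * bil V S x x)"
      by (intro sum_mono square_le_inverse_diag_bil[OF V S _ K])
    also have "\<dots> = c * bil V S x x" by (simp add: c_def sum_distrib_right)
    also have "\<dots> < (c + 1) * bil V S x x" using pos by (simp add: algebra_simps)
    finally show "bil V S x x > 1 / (c + 1) * (\<Sum>i\<in>V. (x i)\<^sup>2)" using c by (simp add: field_simps)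
  qed
qed

text \<open>By Cramer's rule this says \<open>S\<inverse> u u = mdet V S / mdet (insert u V) S\<close>; the row \<open>u\<close> of
  \<open>S\<close> is replaced by the combination of rows that gives the unit vector of \<open>u\<close>.\<close>

lemma mdet_insert_inverse_diag:
  assumes V: "finite V" and u: "u \<notin> V" and K: "is_minv (insert u V) S K"
  shows "K u u * mdet (insert u V) S = mdet V S"
proof -
  let ?U = "insert u V" and ?r = "\<lambda>j. \<Sum>k\<in>insert u V. K u k * S k j"
  have "K u u * mdet ?U S = mdet ?U (S(u := ?r))"
    using V by (intro mdet_row_combination[symmetric]) auto
  also have "\<dots> = (S(u := ?r)) u u * mdet V (S(u := ?r))"
  proof (rule mdet_insert_row_zero[OF V u])
    fix j assume "j \<in> V"
    then show "(S(u := ?r)) u j = 0"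
      using is_minv_sum(2)[OF K, of u j] u by auto
  qed
  also have "(S(u := ?r)) u u = 1" using is_minv_sum(2)[OF K, of u u] by simp
  also have "mdet V (S(u := ?r)) = mdet V S"
    using u by (intro mdet_cong) (auto simp: mat_eq_def)
  finally show ?thesis by simp
qed

lemma sym_pos_def_mdet_pos:
  assumes "finite V" "sym_pos_def V S"
  shows "mdet V S > 0"
  using assms
proof (induction V rule: finite_induct)
  case (insert u V)
  have fin: "finite (insert u V)" using insert by simp
  note K = sym_pos_def_invertible[OF fin insert.prems]
  have "mdet V S > 0" using insert by (auto intro: sym_pos_def_subset[OF fin])
  moreover have "minv (insert u V) S u u > 0"
    using sym_pos_def_inverse_diag_pos[OF fin insert.prems _ K] by simp
  ultimately show ?case
    using mdet_insert_inverse_diag[OF insert.hyps K] by (metis zero_less_mult_pos)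
qed simp

text \<open>Injectivity makes \<open>A\<^sup>T A\<close> positive definite, so
  \<open>(A\<^sup>T A)\<inverse> A\<^sup>T\<close> is a left inverse.\<close>

lemma left_inverse_exists:
  assumes V: "finite V"
    and inj: "\<And>x. (\<And>i. i \<in> V \<Longrightarrow> (\<Sum>j\<in>V. A i j * x j) = 0) \<Longrightarrow> \<forall>i\<in>V. x i = (0::real)"
  shows "\<exists>N. mat_eq V (mmul V N A) idm"
proof -
  define G where "G = mmul V (transp A) A"
  have "bil V G x x = (\<Sum>k\<in>V. (\<Sum>j\<in>V. A k j * x j)\<^sup>2)" for x
  proof -
    have "bil V G x x = (\<Sum>i\<in>V. \<Sum>j\<in>V. \<Sum>k\<in>V. (A k i * x i) * (A k j * x j))"
      by (simp add: bil_def G_def mmul_def transp_def sum_distrib_left sum_distrib_right mult_ac)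
    also have "\<dots> = (\<Sum>i\<in>V. \<Sum>k\<in>V. \<Sum>j\<in>V. (A k i * x i) * (A k j * x j))"
      by (intro sum.cong refl sum.swap)
    also have "\<dots> = (\<Sum>k\<in>V. \<Sum>i\<in>V. \<Sum>j\<in>V. (A k i * x i) * (A k j * x j))"
      by (rule sum.swap)
    finally show ?thesis by (simp add: power2_eq_square sum_product)
  qed
  moreover have "(\<Sum>k\<in>V. (\<Sum>j\<in>V. A k j * x j)\<^sup>2) > 0" if "\<exists>i\<in>V. x i \<noteq> 0" for x
  proof -
    have "\<not> (\<forall>k\<in>V. (\<Sum>j\<in>V. A k j * x j) = 0)"
      using inj[of x] that by auto
    then obtain k where "k \<in> V" "(\<Sum>j\<in>V. A k j * x j) \<noteq> 0" by blast
    then show ?thesis using V by (intro sum_pos2[of V k]) auto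
  qed
  moreover have "G i j = G j i" for i j by (simp add: G_def mmul_def transp_def mult.commute)
  ultimately have "sym_pos_def V G" by (auto simp: sym_pos_def_bil)
  from sym_pos_def_invertible[OF V this]
  have "mat_eq V (mmul V (mmul V (minv V G) (transp A)) A) idm"
    by (simp add: is_minv_def mmul_assoc G_def)
  then show ?thesis by blast
qed

text \<open>Left inverses of \<open>A\<close> and of its transpose yield a left and a right inverse
  of \<open>A\<close>.\<close>

lemma invertibleI:
  assumes V: "finite V"
    and inj: "\<And>x. (\<And>i. i \<in> V \<Longrightarrow> (\<Sum>j\<in>V. A i j * x j) = 0) \<Longrightarrow> \<forall>i\<in>V. x i = (0::real)"
    and inj': "\<And>x. (\<And>i. i \<in> V \<Longrightarrow> (\<Sum>j\<in>V. A j i * x j) = 0) \<Longrightarrow> \<forall>i\<in>V. x i = (0::real)"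
  shows "is_minv V A (minv V A)"
proof -
  have "\<exists>N. mat_eq V (mmul V N A) idm" by (rule left_inverse_exists[OF V inj])
  then obtain N where N: "mat_eq V (mmul V N A) idm" ..
  have "\<exists>N. mat_eq V (mmul V N (transp A)) idm"
    by (rule left_inverse_exists[OF V], rule inj') (simp_all add: transp_def)
  then obtain M where "mat_eq V (mmul V M (transp A)) idm" ..
  from mat_eq_transp[OF this] have "mat_eq V (mmul V A (transp M)) idm" by (simp add: transp_mmul)
  from is_minvI[OF V N this] show ?thesis by (rule is_minv_minv)
qed

section \<open>Covariance matrices of structural equation models\<close>

text \<open>In the kernel of \<open>I - L\<close>, the value \<open>x i\<close> is a combination of
  the values at the successors of \<open>i\<close>, so \<open>x\<close> vanishes by induction from
  the sinks. For the transpose the induction starts at the sources.\<close>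

lemma acyclic_digraph_invertible:
  assumes D: "acyclic_digraph V D" and L: "supported_on V D L"
  shows "is_minv V (\<lambda>i j. idm i j - L i j) (minv V (\<lambda>i j. idm i j - L i j))"
proof (rule invertibleI)
  have V: "finite V" and "finite D" and ac: "acyclic D"
    using D by (auto simp: acyclic_digraph_def intro: finite_subset)
  show "finite V" by fact
  have wf: "wf D" "wf (D\<inverse>)"
    using \<open>finite D\<close> ac finite_acyclic_wf finite_acyclic_wf_converse by blast+
  have idm: "(\<Sum>j\<in>V. idm i j * x j) = x i" "(\<Sum>j\<in>V. idm j i * x j) = x i" if "i \<in> V" for x i
    using V that by (simp_all add: idm_def if_distrib if_distribR cong: if_cong)
  show "\<forall>i\<in>V. x i = 0" if *: "\<And>i. i \<in> V \<Longrightarrow> (\<Sum>j\<in>V. (idm i j - L i j) * x j) = 0" for x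
  proof
    fix i assume "i \<in> V"
    with wf(2) show "x i = 0"
    proof (induction i rule: wf_induct_rule)
      case (less i)
      have "x i = (\<Sum>j\<in>V. L i j * x j)"
        using *[OF less.prems] idm(1)[OF less.prems, of x] by (simp add: left_diff_distrib sum_subtractf)
      also have "\<dots> = 0"
        using less L by (intro sum.neutral) (auto simp: supported_on_def)
      finally show ?case .
    qed
  qed
  show "\<forall>i\<in>V. x i = 0" if *: "\<And>i. i \<in> V \<Longrightarrow> (\<Sum>j\<in>V. (idm j i - L j i) * x j) = 0" for x
  proof
    fix i assume "i \<in> V"
    with wf(1) show "x i = 0"
    proof (induction i rule: wf_induct_rule)
      case (less i)
      have "x i = (\<Sum>j\<in>V. L j i * x j)"
        using *[OF less.prems] idm(2)[OF less.prems, of x] by (simp add: left_diff_distrib sum_subtractf)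
      also have "\<dots> = 0"
        using less L by (intro sum.neutral) (auto simp: supported_on_def)
      finally show ?case .
    qed
  qed
qed

lemma minv_fixpoint:
  assumes "finite V" and M: "is_minv V (\<lambda>i j. idm i j - L i j) M" and "i \<in> V" "j \<in> V"
  shows "M i j = idm i j + (\<Sum>k\<in>V. M i k * L k j)"
proof -
  have "(\<Sum>k\<in>V. M i k * idm k j) = M i j"
    using assms by (simp add: idm_def if_distrib if_distribR cong: if_cong)
  then show ?thesis
    using is_minv_sum(2)[OF M assms(3,4)] by (auto simp: right_diff_distrib sum_subtractf idm_def)
qed

text \<open>\<open>M i j\<close> collects the products of coefficients along directed paths from
  \<open>i\<close> to \<open>j\<close>; the induction splits off the last edge by
  \<open>M = I + M L\<close>.\<close>

lemma minv_reachable: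
  assumes D: "acyclic_digraph V D" and L: "supported_on V D L"
    and M: "is_minv V (\<lambda>i j. idm i j - L i j) M" and ij: "i \<in> V" "j \<in> V" and nz: "M i j \<noteq> 0"
  shows "(i, j) \<in> D\<^sup>*"
proof -
  have V: "finite V" and wf: "wf D"
    using D by (auto simp: acyclic_digraph_def intro: finite_subset finite_acyclic_wf)
  from wf show ?thesis using ij(2) nz
  proof (induction j rule: wf_induct_rule)
    case (less j)
    show ?case
    proof (cases "i = j")
      case False
      then have "(\<Sum>k\<in>V. M i k * L k j) \<noteq> 0"
        using minv_fixpoint[OF V M ij(1) less.prems(1)] less.prems(2) by (simp add: idm_def)
      then obtain k where k: "k \<in> V" "M i k * L k j \<noteq> 0" by (meson sum.neutral)
      then have "(k, j) \<in> D" using L less.prems by (auto simp: supported_on_def)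
      then show ?thesis using less.IH[of k] k by auto
    qed simp
  qed
qed

lemma sem_cov_eq:
  "sem_cov V L W i j = bil V W (\<lambda>k. minv V (\<lambda>i j. idm i j - L i j) k i) (\<lambda>k. minv V (\<lambda>i j. idm i j - L i j) k j)"
  by (simp add: sem_cov_def Let_def bil_alt' mmul_def transp_def)

text \<open>The form is that of \<open>W\<close> after the substitution of \<open>M x\<close> for
  \<open>x\<close>, so positive definiteness reduces to injectivity of \<open>M\<close>.\<close>

lemma bil_sem_cov:
  assumes "finite V"
  shows "bil V (sem_cov V L W) x y =
    bil V W (\<lambda>k. \<Sum>i\<in>V. minv V (\<lambda>i j. idm i j - L i j) k i * x i) (\<lambda>k. \<Sum>i\<in>V. minv V (\<lambda>i j. idm i j - L i j) k i * y i)"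
proof -
  define M where "M = minv V (\<lambda>i j. idm i j - L i j)"
  have bsl: "bil V W (\<lambda>k. \<Sum>i\<in>I. f i k) z = (\<Sum>i\<in>I. bil V W (f i) z)" for f z and I :: "'a set"
    by (induction I rule: infinite_finite_induct) (simp_all add: bil_add_left, simp_all add: bil_def)
  have bsr: "bil V W z (\<lambda>k. \<Sum>i\<in>I. f i k) = (\<Sum>i\<in>I. bil V W z (f i))" for f z and I :: "'a set"
    by (induction I rule: infinite_finite_induct) (simp_all add: bil_add_right, simp_all add: bil_def)
  have "bil V W (\<lambda>k. \<Sum>i\<in>V. M k i * x i) (\<lambda>k. \<Sum>i\<in>V. M k i * y i)
      = (\<Sum>i\<in>V. \<Sum>j\<in>V. bil V W (\<lambda>k. x i * M k i) (\<lambda>k. y j * M k j))"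
    unfolding bsl bsr by (simp add: mult.commute)
  also have "\<dots> = bil V (sem_cov V L W) x y"
    unfolding bil_scale_left bil_scale_right sem_cov_eq M_def[symmetric] bil_def[of V "sem_cov V L W"]
    by (simp add: mult_ac)
  finally show ?thesis by (simp add: M_def)
qed

lemma sem_cov_sym_pos_def:
  assumes D: "acyclic_digraph V D" and L: "supported_on V D L" and W: "sym_pos_def V W"
  shows "sym_pos_def V (sem_cov V L W)"
  unfolding sym_pos_def_bil
proof (intro conjI ballI allI impI)
  have V: "finite V" using D by (simp add: acyclic_digraph_def)
  show "sem_cov V L W i j = sem_cov V L W j i" for i j
    unfolding sem_cov_eq using sym_pos_def_sym[OF W] by (rule bil_commute)
  define M where "M = minv V (\<lambda>i j. idm i j - L i j)"
  have M: "is_minv V (\<lambda>i j. idm i j - L i j) M"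
    unfolding M_def by (rule acyclic_digraph_invertible[OF D L])
  fix x assume x: "\<exists>i\<in>V. x i \<noteq> (0::real)"
  define y where "y k = (\<Sum>i\<in>V. M k i * x i)" for k
  have "\<exists>k\<in>V. y k \<noteq> 0"
  proof (rule ccontr)
    assume *: "\<not> ?thesis"
    have "x i = 0" if i: "i \<in> V" for i
    proof -
      have "0 = (\<Sum>k\<in>V. (idm i k - L i k) * y k)" using * by simp
      also have "\<dots> = bil V M (\<lambda>k. idm i k - L i k) x" by (simp add: bil_alt y_def)
      also have "\<dots> = (\<Sum>j\<in>V. (if i = j then 1 else 0) * x j)"
        unfolding bil_alt' using is_minv_sum(1)[OF M i] by (intro sum.cong) auto
      also have "\<dots> = x i" using V i by (simp add: if_distrib if_distribR cong: if_cong)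
      finally show ?thesis by simp
    qed
    with x show False by blast
  qed
  then show "bil V (sem_cov V L W) x x > 0"
    using W unfolding bil_sem_cov[OF V] M_def[symmetric] y_def[symmetric] sym_pos_def_bil by blast
qed

lemma sem_cov_cong:
  assumes "mat_eq V L L'" "mat_eq V W W'"
  shows "mat_eq V (sem_cov V L W) (sem_cov V L' W')"
proof -
  have "mat_eq V (\<lambda>i j. idm i j - L i j) (\<lambda>i j. idm i j - L' i j)"
    using assms(1) by (simp add: mat_eq_def)
  from minv_cong[OF this] show ?thesis
    unfolding mat_eq_def sem_cov_eq using assms(2) by (auto intro: bil_cong)
qed

lemma bil_sum_squares:
  "bil V (\<lambda>i j. \<Sum>u\<in>U. w u * a u i * a u j) x y = (\<Sum>u\<in>U. w u * (\<Sum>i\<in>V. a u i * x i) * (\<Sum>j\<in>V. a u j * y j))"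
proof -
  have "bil V (\<lambda>i j. \<Sum>u\<in>U. w u * a u i * a u j) x y =
      (\<Sum>i\<in>V. \<Sum>j\<in>V. \<Sum>u\<in>U. w u * (a u i * x i) * (a u j * y j))"
    by (simp add: bil_def sum_distrib_left sum_distrib_right mult_ac)
  also have "\<dots> = (\<Sum>i\<in>V. \<Sum>u\<in>U. \<Sum>j\<in>V. w u * (a u i * x i) * (a u j * y j))"
    by (intro sum.cong refl sum.swap)
  also have "\<dots> = (\<Sum>u\<in>U. \<Sum>i\<in>V. \<Sum>j\<in>V. w u * (a u i * x i) * (a u j * y j))"
    by (rule sum.swap)
  also have "\<dots> = (\<Sum>u\<in>U. w u * (\<Sum>i\<in>V. a u i * x i) * (\<Sum>j\<in>V. a u j * y j))"
    by (simp only: mult.assoc sum_product) (simp add: sum_distrib_left)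
  finally show ?thesis .
qed

lemma bil_pos_diag:
  assumes "finite U" "W \<in> pos_diag U"
  shows "bil U W x y = (\<Sum>u\<in>U. W u u * x u * y u)"
  unfolding bil_alt
proof (intro sum.cong refl)
  fix u assume u: "u \<in> U"
  have "(\<Sum>j\<in>U. W u j * y j) = (\<Sum>j\<in>U. if u = j then W u u * y u else 0)"
    using assms u by (intro sum.cong) (auto simp: pos_diag_def)
  then show "x u * (\<Sum>j\<in>U. W u j * y j) = W u u * x u * y u"
    using assms u by (simp add: mult_ac)
qed

lemma pos_diag_sym_pos_def:
  assumes U: "finite U" and W: "W \<in> pos_diag U"
  shows "sym_pos_def U W"
  unfolding sym_pos_def_bil bil_pos_diag[OF assms]
proof (intro conjI ballI allI impI)
  show "W i j = W j i" if "i \<in> U" "j \<in> U" for i j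
    using W that unfolding pos_diag_def by (cases "i = j") auto
  have W0: "W u u > 0" if "u \<in> U" for u using W that by (simp add: pos_diag_def)
  fix x assume "\<exists>i\<in>U. x i \<noteq> (0::real)"
  then obtain i where i: "i \<in> U" "x i \<noteq> 0" by blast
  have "0 < W i i * (x i)\<^sup>2" using i W0 by (intro mult_pos_pos) auto
  then have "0 < W i i * x i * x i" by (simp add: power2_eq_square mult.assoc)
  moreover have "0 \<le> W u u * x u * x u" if "u \<in> U" for u
    using W0[OF that] by (simp add: mult.assoc)
  ultimately show "(\<Sum>u\<in>U. W u u * x u * x u) > 0"
    using U i by (intro sum_pos2[of U i]) auto
qed

section \<open>Gaussian measures\<close>

lemma mvn_cong:
  assumes "mat_eq V S S'"
  shows "mvn V \<mu> S = mvn V \<mu> S'"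
  unfolding mvn_def mvn_density_def minv_cong[OF assms] mdet_cong[OF assms] ..

lemma mvn_density_altdef:
  "mvn_density V \<mu> S x = exp (- bil V (minv V S) (\<lambda>i. x i - \<mu> i) (\<lambda>i. x i - \<mu> i) / 2)
    / sqrt ((2 * pi) ^ card V * mdet V S)"
  by (simp add: mvn_density_def bil_def)

lemma borel_measurable_mvn_density [measurable]:
  "mvn_density V \<mu> S \<in> borel_measurable (Pi\<^sub>M V (\<lambda>_. lborel))"
  unfolding mvn_density_def by measurable

lemma mvn_density_pos:
  assumes "finite V" "sym_pos_def V S"
  shows "mvn_density V \<mu> S x > 0"
  using sym_pos_def_mdet_pos[OF assms] by (simp add: mvn_density_def)

text \<open>Dropping \<open>u\<close> from the covariance matrix replaces the precision matrix by a
  Schur complement, the quadratic form that remains after integrating out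
  \<open>x u\<close>.\<close>

lemma is_minv_Schur_complement:
  assumes V: "finite V" and u: "u \<notin> V" and K: "is_minv (insert u V) S K" and K0: "K u u \<noteq> 0"
    and S: "sym_pos_def V S"
  shows "mat_eq V (minv V S) (\<lambda>i j. K i j - K i u * K u j / K u u)"
proof -
  let ?K = "\<lambda>i j. K i j - K i u * K u j / K u u"
  have "mat_eq V (mmul V S ?K) idm"
    unfolding mat_eq_def
  proof (intro ballI)
    fix i j assume i: "i \<in> V" and j: "j \<in> V"
    have iu: "i \<noteq> u" using i u by auto
    have 1: "(\<Sum>k\<in>V. S i k * K k j) = (if i = j then 1 else 0) - S i u * K u j"
      using is_minv_sum(1)[OF K, of i j] i j V u by auto
    have 2: "(\<Sum>k\<in>V. S i k * K k u) = - S i u * K u u"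
      using is_minv_sum(1)[OF K, of i u] i V u iu by simp
    have "mmul V S ?K i j = (\<Sum>k\<in>V. S i k * K k j) - (\<Sum>k\<in>V. S i k * K k u) * (K u j / K u u)"
      by (simp add: mmul_def right_diff_distrib sum_subtractf sum_distrib_right sum_divide_distrib mult.assoc)
    then show "mmul V S ?K i j = idm i j"
      using K0 by (simp add: 1 2 idm_def)
  qed
  moreover have "mat_eq V (mmul V (minv V S) S) idm"
    using sym_pos_def_invertible[OF V S] by (simp add: is_minv_def)
  ultimately show ?thesis using V by (blast intro: left_inverse_eq_right_inverse)
qed

text \<open>The conditional law of the coordinate \<open>u\<close> given the others is normal with precision
  \<open>K u u\<close>.\<close>

lemma mvn_density_insert:
  assumes V: "finite V" and u: "u \<notin> V" and S: "sym_pos_def (insert u V) S"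
  defines "K \<equiv> minv (insert u V) S"
  shows "mvn_density (insert u V) \<mu> S x = mvn_density V \<mu> S x *
    normal_density (\<mu> u - (\<Sum>k\<in>V. K u k * (x k - \<mu> k)) / K u u) (1 / sqrt (K u u)) (x u)"
proof -
  let ?U = "insert u V"
  define y where "y i = x i - \<mu> i" for i
  define b where "b = (\<Sum>k\<in>V. K u k * y k)"
  have U: "finite ?U" using V by simp
  have K: "is_minv ?U S K" unfolding K_def by (rule sym_pos_def_invertible[OF U S])
  have SV: "sym_pos_def V S" by (rule sym_pos_def_subset[OF U _ S]) auto
  have K0: "K u u > 0" using sym_pos_def_inverse_diag_pos[OF U S _ K] by simp
  have det: "mdet V S = K u u * mdet ?U S" using mdet_insert_inverse_diag[OF V u K] by simp
  have detU: "mdet ?U S > 0" by (rule sym_pos_def_mdet_pos[OF U S])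
  have symK: "K i j = K j i" if "i \<in> ?U" "j \<in> ?U" for i j
    using is_minv_symmetric[OF U K sym_pos_def_sym[OF S] that] .
  have b': "(\<Sum>k\<in>V. y k * K k u) = b"
    unfolding b_def by (intro sum.cong) (auto simp: symK)
  have qU: "bil ?U K y y = K u u * (y u)\<^sup>2 + 2 * y u * b + bil V K y y"
    unfolding bil_insert[OF V u] b' b_def[symmetric] by simp
  have qV: "bil V (minv V S) y y = bil V K y y - b\<^sup>2 / K u u"
  proof -
    have "bil V (minv V S) y y = bil V (\<lambda>i j. K i j - K i u * K u j / K u u) y y"
      using is_minv_Schur_complement[OF V u K _ SV] K0 by (intro bil_cong) auto
    also have "\<dots> = (\<Sum>i\<in>V. y i * ((\<Sum>j\<in>V. K i j * y j) - K i u * b / K u u))"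
      unfolding bil_alt
      by (simp add: b_def left_diff_distrib sum_subtractf sum_distrib_left sum_divide_distrib mult.assoc)
    also have "\<dots> = bil V K y y - (\<Sum>i\<in>V. y i * K i u) * b / K u u"
      by (simp add: bil_alt right_diff_distrib sum_subtractf sum_distrib_right sum_divide_distrib mult.assoc)
    finally show ?thesis unfolding b' by (simp add: power2_eq_square)
  qed
  let ?m = "\<mu> u - b / K u u"
  \<comment> \<open>Completing the square in \<open>x u\<close>.\<close>
  have e: "- bil ?U K y y / 2 = - bil V (minv V S) y y / 2 + (- (x u - ?m)\<^sup>2 / (2 * (1 / sqrt (K u u))\<^sup>2))"
  proof -
    have "x u - ?m = y u + b / K u u" by (simp add: y_def)
    then have "(x u - ?m)\<^sup>2 * K u u = K u u * (y u)\<^sup>2 + 2 * y u * b + b\<^sup>2 / K u u"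
      using K0 by (simp add: power2_eq_square field_simps)
    moreover have "(1 / sqrt (K u u))\<^sup>2 = 1 / K u u" using K0 by (simp add: power_divide)
    ultimately show ?thesis unfolding qU qV by (simp add: field_simps)
  qed
  have c: "sqrt ((2 * pi) ^ card ?U * mdet ?U S) =
      sqrt ((2 * pi) ^ card V * mdet V S) * sqrt (2 * pi * (1 / sqrt (K u u))\<^sup>2)"
  proof -
    have "(1 / sqrt (K u u))\<^sup>2 = 1 / K u u" using K0 by (simp add: power_divide)
    then have "(2 * pi) ^ card V * mdet V S * (2 * pi * (1 / sqrt (K u u))\<^sup>2) = (2 * pi) ^ card ?U * mdet ?U S"
      using K0 V u by (simp add: det)
    then show ?thesis by (simp add: real_sqrt_mult[symmetric])
  qed
  have "mvn_density ?U \<mu> S x = exp (- bil ?U K y y / 2) / sqrt ((2 * pi) ^ card ?U * mdet ?U S)"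
    by (simp add: mvn_density_altdef K_def y_def[abs_def])
  also have "\<dots> = mvn_density V \<mu> S x * normal_density ?m (1 / sqrt (K u u)) (x u)"
    unfolding e c exp_add by (simp add: mvn_density_altdef normal_density_def y_def[abs_def])
  finally show ?thesis by (simp add: b_def y_def)
qed

section \<open>Marginals of normal distributions\<close>

lemma sets_mvn [simp]: "sets (mvn V \<mu> S) = sets (Pi\<^sub>M V (\<lambda>_. lborel))"
  by (simp add: mvn_def)

lemma space_mvn [simp]: "space (mvn V \<mu> S) = space (Pi\<^sub>M V (\<lambda>_. lborel))"
  by (simp add: mvn_def)

lemma measurable_mvn [simp]: "measurable (mvn V \<mu> S) N = measurable (Pi\<^sub>M V (\<lambda>_. lborel)) N"
  by (rule measurable_cong_sets) simp_all

text \<open>Fubini: neither the density on \<open>V\<close> nor the conditional mean depends on the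
  coordinate \<open>u\<close>, so the inner integral is that of a normal density.\<close>

lemma marginal_mvn_insert:
  assumes V: "finite V" and u: "u \<notin> V" and S: "sym_pos_def (insert u V) S"
  shows "marginal V (mvn (insert u V) \<mu> S) = mvn V \<mu> S"
proof (rule measure_eqI)
  let ?U = "insert u V"
  let ?L = "\<lambda>W :: 'a set. Pi\<^sub>M W (\<lambda>_. lborel :: real measure)"
  interpret product_sigma_finite "\<lambda>_ :: 'a. lborel :: real measure" ..
  show "sets (marginal V (mvn ?U \<mu> S)) = sets (mvn V \<mu> S)"
    by (simp add: marginal_def)
  fix A assume "A \<in> sets (marginal V (mvn ?U \<mu> S))"
  then have A [measurable]: "A \<in> sets (?L V)" by (simp add: marginal_def)
  have r [measurable]: "(\<lambda>x. restrict x V) \<in> measurable (?L ?U) (?L V)"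
    by (rule measurable_restrict_subset) auto
  define K where "K = minv ?U S"
  have U: "finite ?U" using V by simp
  have K0: "K u u > 0"
    using sym_pos_def_inverse_diag_pos[OF U S _ sym_pos_def_invertible[OF U S]] by (simp add: K_def)
  define m where "m x = \<mu> u - (\<Sum>k\<in>V. K u k * (x k - \<mu> k)) / K u u" for x
  have "emeasure (marginal V (mvn ?U \<mu> S)) A =
      emeasure (mvn ?U \<mu> S) ((\<lambda>x. restrict x V) -` A \<inter> space (?L ?U))"
    unfolding marginal_def by (subst emeasure_distr) auto
  also have "\<dots> = (\<integral>\<^sup>+ x. ennreal (mvn_density ?U \<mu> S x) *
      indicator ((\<lambda>x. restrict x V) -` A \<inter> space (?L ?U)) x \<partial>?L ?U)"
    unfolding mvn_def by (subst emeasure_density) auto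
  also have "\<dots> = (\<integral>\<^sup>+ x. ennreal (mvn_density ?U \<mu> S x) * indicator A (restrict x V) \<partial>?L ?U)"
    by (intro nn_integral_cong) (auto simp: indicator_def)
  also have "\<dots> = (\<integral>\<^sup>+ x. (\<integral>\<^sup>+ y. ennreal (mvn_density ?U \<mu> S (x(u := y))) *
      indicator A (restrict (x(u := y)) V) \<partial>lborel) \<partial>?L V)"
    using V u by (intro product_nn_integral_insert) measurable
  also have "\<dots> = (\<integral>\<^sup>+ x. ennreal (mvn_density V \<mu> S x) * indicator A x \<partial>?L V)"
  proof (intro nn_integral_cong)
    fix x assume x: "x \<in> space (?L V)"
    have rx: "restrict (x(u := y)) V = x" for y
      using x u by (auto simp: space_PiM PiE_def extensional_def restrict_def fun_eq_iff)
    have dx: "mvn_density V \<mu> S (x(u := y)) = mvn_density V \<mu> S x" for y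
    proof -
      have "bil V (minv V S) (\<lambda>i. (x(u := y)) i - \<mu> i) (\<lambda>i. (x(u := y)) i - \<mu> i) =
          bil V (minv V S) (\<lambda>i. x i - \<mu> i) (\<lambda>i. x i - \<mu> i)"
        using u by (intro bil_cong) auto
      then show ?thesis by (simp add: mvn_density_altdef)
    qed
    have mx: "m (x(u := y)) = m x" for y
      unfolding m_def using u by (auto intro!: sum.cong)
    have "mvn_density ?U \<mu> S (x(u := y)) = mvn_density V \<mu> S x * normal_density (m x) (1 / sqrt (K u u)) y" for y
      using mvn_density_insert[OF V u S, of \<mu> "x(u := y)"]
      unfolding K_def[symmetric] m_def[symmetric] mx dx by simp
    then have "(\<integral>\<^sup>+ y. ennreal (mvn_density ?U \<mu> S (x(u := y))) * indicator A (restrict (x(u := y)) V) \<partial>lborel) =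
       (\<integral>\<^sup>+ y. ennreal (mvn_density V \<mu> S x) * indicator A x *
          ennreal (normal_density (m x) (1 / sqrt (K u u)) y) \<partial>lborel)"
      unfolding rx by (intro nn_integral_cong) (simp add: ennreal_mult'' mult_ac)
    also have "\<dots> = ennreal (mvn_density V \<mu> S x) * indicator A x *
        (\<integral>\<^sup>+ y. ennreal (normal_density (m x) (1 / sqrt (K u u)) y) \<partial>lborel)"
      by (intro nn_integral_cmult) auto
    also have "(\<integral>\<^sup>+ y. ennreal (normal_density (m x) (1 / sqrt (K u u)) y) \<partial>lborel) = 1"
      using K0 by (subst nn_integral_eq_integral) auto
    finally show "(\<integral>\<^sup>+ y. ennreal (mvn_density ?U \<mu> S (x(u := y))) *
        indicator A (restrict (x(u := y)) V) \<partial>lborel) = ennreal (mvn_density V \<mu> S x) * indicator A x"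
      by (simp only: mult_1_right)
  qed
  also have "\<dots> = emeasure (mvn V \<mu> S) A"
    unfolding mvn_def by (subst emeasure_density) auto
  finally show "emeasure (marginal V (mvn ?U \<mu> S)) A = emeasure (mvn V \<mu> S) A" .
qed

lemma marginal_marginal:
  assumes "V \<subseteq> V'" "V' \<subseteq> U" and M: "sets M = sets (Pi\<^sub>M U (\<lambda>_. lborel))"
  shows "marginal V (marginal V' M) = marginal V M"
proof -
  have "(\<lambda>x. restrict x V') \<in> measurable M (Pi\<^sub>M V' (\<lambda>_. lborel))"
    unfolding measurable_cong_sets[OF M refl] using assms(2) by (rule measurable_restrict_subset)
  moreover have "(\<lambda>x. restrict x V) \<in> measurable (Pi\<^sub>M V' (\<lambda>_. lborel)) (Pi\<^sub>M V (\<lambda>_. lborel :: real measure))"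
    using assms(1) by (rule measurable_restrict_subset)
  moreover have "(\<lambda>x. restrict x V) \<circ> (\<lambda>x. restrict x V') = (\<lambda>x :: 'a \<Rightarrow> real. restrict x V)"
    using assms(1) by (auto simp: fun_eq_iff restrict_def)
  ultimately show ?thesis unfolding marginal_def by (simp add: distr_distr)
qed

lemma marginal_mvn:
  assumes U: "finite U" and VU: "V \<subseteq> U" and S: "sym_pos_def U S"
  shows "marginal V (mvn U \<mu> S) = mvn V \<mu> S"
proof -
  have "finite W \<Longrightarrow> W \<inter> V = {} \<Longrightarrow> sym_pos_def (V \<union> W) S \<Longrightarrow> marginal V (mvn (V \<union> W) \<mu> S) = mvn V \<mu> S" for W
  proof (induction W rule: finite_induct)
    case empty
    have "distr (mvn V \<mu> S) (Pi\<^sub>M V (\<lambda>_. lborel)) (\<lambda>x. restrict x V) = distr (mvn V \<mu> S) (mvn V \<mu> S) (\<lambda>x. x)"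
      by (rule distr_cong) (auto simp: space_PiM PiE_def extensional_restrict)
    then show ?case by (simp add: marginal_def)
  next
    case (insert w W)
    have fin: "finite (V \<union> insert w W)" using insert.hyps U VU by (auto intro: finite_subset)
    have "marginal V (mvn (V \<union> insert w W) \<mu> S) = marginal V (marginal (V \<union> W) (mvn (V \<union> insert w W) \<mu> S))"
      by (rule marginal_marginal[symmetric, where U = "V \<union> insert w W"]) auto
    also have "marginal (V \<union> W) (mvn (V \<union> insert w W) \<mu> S) = mvn (V \<union> W) \<mu> S"
      using marginal_mvn_insert[of "V \<union> W" w S] insert fin by auto
    also have "marginal V \<dots> = mvn V \<mu> S"
      using insert.IH insert.prems sym_pos_def_subset[OF fin _ insert.prems(2), of "V \<union> W"] by auto
    finally show ?case .
  qed
  from this[of "U - V"] show ?thesis using assms by (auto simp: Un_absorb1)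
qed

text \<open>Equal measures have densities that agree only almost everywhere. A box around
  \<open>x\<close> has positive measure and is not contained in the null set, so shrinking boxes
  give points tending to \<open>x\<close> at which \<open>g\<close> is \<open>c\<close>. Convergence
  is asked on \<open>V\<close> only, because these points are extensional while \<open>x\<close> is
  any function.\<close>

lemma AE_PiM_lborel_continuous_eq:
  fixes g :: "('a \<Rightarrow> real) \<Rightarrow> real"
  assumes V: "finite V" and AE: "AE x in Pi\<^sub>M V (\<lambda>_. lborel). g x = c"
    and cont: "\<And>y. (\<And>i. i \<in> V \<Longrightarrow> (\<lambda>n. y n i) \<longlonglongrightarrow> x i) \<Longrightarrow> (\<lambda>n. g (y n)) \<longlonglongrightarrow> g x"
  shows "g x = c"
proof -
  interpret product_sigma_finite "\<lambda>_ :: 'a. lborel :: real measure" ..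
  let ?L = "Pi\<^sub>M V (\<lambda>_. lborel :: real measure)"
  obtain N where N: "{x \<in> space ?L. g x \<noteq> c} \<subseteq> N" "emeasure ?L N = 0" "N \<in> sets ?L"
    by (rule AE_E[OF AE])
  have "\<exists>y. g y = c \<and> (\<forall>i\<in>V. \<bar>y i - x i\<bar> \<le> 1 / real (Suc n))" for n
  proof -
    define B where "B = (\<Pi>\<^sub>E i\<in>V. {x i - 1 / real (Suc n) .. x i + 1 / real (Suc n)})"
    have "emeasure ?L B = (\<Prod>i\<in>V. emeasure lborel {x i - 1 / real (Suc n) .. x i + 1 / real (Suc n)})"
      unfolding B_def using V by (intro emeasure_PiM) auto
    also have "\<dots> = (\<Prod>i\<in>V. ennreal (2 / real (Suc n)))"
      by (intro prod.cong refl) (subst emeasure_lborel_Icc, auto)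
    also have "\<dots> \<noteq> 0" using V by simp
    finally have "\<not> B \<subseteq> N" using N(2,3) emeasure_mono[of B N ?L] by auto
    then obtain y where "y \<in> B" "y \<notin> N" by auto
    moreover from this have "y \<in> space ?L" by (auto simp: B_def space_PiM PiE_def)
    ultimately have "g y = c" using N(1) by auto
    moreover have "\<bar>y i - x i\<bar> \<le> 1 / real (Suc n)" if "i \<in> V" for i
    proof -
      have "y i \<in> {x i - 1 / real (Suc n) .. x i + 1 / real (Suc n)}"
        using \<open>y \<in> B\<close> that unfolding B_def by (rule PiE_mem)
      then show ?thesis unfolding atLeastAtMost_iff by linarith
    qed
    ultimately show ?thesis by blast
  qed
  then obtain y where y: "\<And>n. g (y n) = c" "\<And>n i. i \<in> V \<Longrightarrow> \<bar>y n i - x i\<bar> \<le> 1 / real (Suc n)"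
    by metis
  have "(\<lambda>n. y n i) \<longlonglongrightarrow> x i" if "i \<in> V" for i
  proof -
    have "(\<lambda>n. y n i - x i) \<longlonglongrightarrow> 0"
      using y(2)[OF that] by (intro Lim_null_comparison[OF _ lim_inverse_n'[THEN LIMSEQ_Suc]]) (auto intro: always_eventually)
    then show ?thesis by (simp add: LIM_zero_iff)
  qed
  from cont[OF this] show ?thesis using y(1) by (simp add: LIMSEQ_const_iff)
qed

text \<open>A second difference removes linear and constant terms, and with them the mean, and
  leaves the polarization.\<close>

lemma bil_second_difference:
  "bil V A (\<lambda>i. x i + y i + m i) (\<lambda>i. x i + y i + m i) - bil V A (\<lambda>i. x i + m i) (\<lambda>i. x i + m i)
     - bil V A (\<lambda>i. y i + m i) (\<lambda>i. y i + m i) + bil V A m m = bil V A x y + bil V A y x"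
  unfolding bil_add_left bil_add_right by (simp add: algebra_simps)

text \<open>Taking logarithms, the difference of the two quadratic polynomials is constant, first
  almost everywhere and then by continuity everywhere. Its second differences along unit vectors
  identify the precision matrices.\<close>

lemma mvn_inject:
  assumes V: "finite V" and S: "sym_pos_def V S" and S': "sym_pos_def V S'"
    and eq: "mvn V \<mu> S = mvn V \<mu>' S'"
  shows "mat_eq V S S'"
proof -
  interpret product_sigma_finite "\<lambda>_ :: 'a. lborel :: real measure" ..
  interpret finite_product_sigma_finite "\<lambda>_ :: 'a. lborel :: real measure" V by standard fact
  let ?L = "Pi\<^sub>M V (\<lambda>_. lborel :: real measure)"
  define K K' where "K = minv V S" and "K' = minv V S'"
  define g where "g x = bil V K (\<lambda>i. x i + - \<mu> i) (\<lambda>i. x i + - \<mu> i) - bil V K' (\<lambda>i. x i + - \<mu>' i) (\<lambda>i. x i + - \<mu>' i)" for x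
  define c c' where "c = sqrt ((2 * pi) ^ card V * mdet V S)" and "c' = sqrt ((2 * pi) ^ card V * mdet V S')"
  have c: "c > 0" "c' > 0"
    using sym_pos_def_mdet_pos[OF V S] sym_pos_def_mdet_pos[OF V S'] by (simp_all add: c_def c'_def)
  have "AE x in ?L. ennreal (mvn_density V \<mu> S x) = ennreal (mvn_density V \<mu>' S' x)"
    using eq unfolding mvn_def by (intro density_unique) auto
  then have "AE x in ?L. g x = 2 * ln c' - 2 * ln c"
  proof (rule AE_mp, intro AE_I2 impI)
    fix x assume "ennreal (mvn_density V \<mu> S x) = ennreal (mvn_density V \<mu>' S' x)"
    then have "ln (mvn_density V \<mu> S x) = ln (mvn_density V \<mu>' S' x)"
      using mvn_density_pos[OF V S] mvn_density_pos[OF V S'] by (simp add: less_imp_le)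
    moreover have "ln (mvn_density V \<mu> S x) = - bil V K (\<lambda>i. x i - \<mu> i) (\<lambda>i. x i - \<mu> i) / 2 - ln c"
      unfolding mvn_density_altdef c_def[symmetric] K_def[symmetric] using c by (subst ln_div) auto
    moreover have "ln (mvn_density V \<mu>' S' x) = - bil V K' (\<lambda>i. x i - \<mu>' i) (\<lambda>i. x i - \<mu>' i) / 2 - ln c'"
      unfolding mvn_density_altdef c'_def[symmetric] K'_def[symmetric] using c by (subst ln_div) auto
    ultimately show "g x = 2 * ln c' - 2 * ln c"
      by (simp add: g_def)
  qed
  then have g: "g x = 2 * ln c' - 2 * ln c" for x
  proof (rule AE_PiM_lborel_continuous_eq[OF V])
    fix y assume "\<And>i. i \<in> V \<Longrightarrow> (\<lambda>n. y n i) \<longlonglongrightarrow> x i"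
    then show "(\<lambda>n. g (y n)) \<longlonglongrightarrow> g x"
      unfolding g_def bil_def by (intro tendsto_intros) auto
  qed
  have "K i j = K' i j" if ij: "i \<in> V" "j \<in> V" for i j
  proof -
    define e :: "'a \<Rightarrow> 'a \<Rightarrow> real" where "e i k = (if k = i then 1 else 0)" for i k
    have "g (\<lambda>k. e i k + e j k) - g (e i) - g (e j) + g (\<lambda>_. 0) = 0"
      unfolding g by simp
    then have "bil V K (e i) (e j) + bil V K (e j) (e i) = bil V K' (e i) (e j) + bil V K' (e j) (e i)"
      unfolding g_def
      using bil_second_difference[of V K "e i" "e j" "\<lambda>i. - \<mu> i"] bil_second_difference[of V K' "e i" "e j" "\<lambda>i. - \<mu>' i"]
      by simp
    then have "K i j + K j i = K' i j + K' j i"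
      unfolding e_def using V ij by (simp add: bil_indicator)
    moreover have "K j i = K i j" "K' j i = K' i j"
      using is_minv_symmetric[OF V sym_pos_def_invertible[OF V S] sym_pos_def_sym[OF S]]
        is_minv_symmetric[OF V sym_pos_def_invertible[OF V S'] sym_pos_def_sym[OF S']] ij
      by (simp_all add: K_def K'_def)
    ultimately show ?thesis by simp
  qed
  then have KK: "mat_eq V K K'" by (simp add: mat_eq_def)
  have "mat_eq V (mmul V S K) idm" "mat_eq V (mmul V K' S') idm"
    using sym_pos_def_invertible[OF V S] sym_pos_def_invertible[OF V S'] by (simp_all add: is_minv_def K_def K'_def)
  moreover from this have "mat_eq V (mmul V S K') idm"
    using mat_eq_mmul[OF mat_eq_refl KK, of S] by (meson mat_eq_sym mat_eq_trans)
  ultimately show ?thesis using V by (blast intro: left_inverse_eq_right_inverse)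
qed

section \<open>Decomposable graphs\<close>

lemma decomposable_subset: "decomposable V B \<Longrightarrow> V' \<subseteq> V \<Longrightarrow> decomposable V' B"
  unfolding decomposable_def induced_cycle_def by (meson subset_trans)

section \<open>Shortest walks and Dirac's theorem on simplicial vertices\<close>

definition simplicial :: "'a set \<Rightarrow> ('a \<times> 'a) set \<Rightarrow> 'a \<Rightarrow> bool" where
  "simplicial V B w \<longleftrightarrow>
     (\<forall>x\<in>V. \<forall>y\<in>V. (w, x) \<in> B \<and> (w, y) \<in> B \<and> x \<noteq> y \<longrightarrow> (x, y) \<in> B)"

text \<open>Only interior vertices are confined to \<open>A\<close>; the ends \<open>x\<close> and
  \<open>y\<close> will be taken from the boundary of \<open>A\<close>.\<close>

definition walk_through :: "'a set \<Rightarrow> ('a \<times> 'a) set \<Rightarrow> 'a \<Rightarrow> 'a \<Rightarrow> nat \<Rightarrow> (nat \<Rightarrow> 'a) \<Rightarrow> bool" where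
  "walk_through A B x y n f \<longleftrightarrow> f 0 = x \<and> f n = y \<and>
     (\<forall>i<n. (f i, f (Suc i)) \<in> B) \<and> (\<forall>i. 0 < i \<and> i < n \<longrightarrow> f i \<in> A)"

lemma walk_through_shortcut:
  assumes f: "walk_through A B x y n f" and ij: "Suc i < j" "j \<le> n" and B: "(f i, f j) \<in> B"
  shows "\<exists>m<n. \<exists>g. walk_through A B x y m g"
proof -
  define d where "d = j - Suc i"
  define g where "g k = (if k \<le> i then f k else f (k + d))" for k
  have d: "0 < d" "i + d < n" "Suc i + d = j" using ij by (auto simp: d_def)
  have "walk_through A B x y (n - d) g"
    unfolding walk_through_def
  proof (intro conjI allI impI)
    show "g 0 = x" "g (n - d) = y" using f d by (auto simp: g_def walk_through_def)
    show "(g k, g (Suc k)) \<in> B" if "k < n - d" for k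
    proof (cases k i rule: linorder_cases)
      case equal
      then show ?thesis using B d(3) by (simp add: g_def)
    qed (use f that d in \<open>auto simp: g_def walk_through_def\<close>)
    show "g k \<in> A" if "0 < k \<and> k < n - d" for k
      using f that d by (auto simp: g_def walk_through_def)
  qed
  moreover have "n - d < n" using d by auto
  ultimately show ?thesis by blast
qed

text \<open>A chord would give a shortcut, and a repeated vertex would create a chord: the edge
  leaving the second occurrence also leaves the first.\<close>

lemma shortest_walk_induced:
  assumes f: "walk_through A B x y n f" and min: "\<And>m g. walk_through A B x y m g \<Longrightarrow> n \<le> m"
    and B: "sym B" "\<And>v. (v, v) \<notin> B" and xy: "x \<noteq> y"
  shows "inj_on f {..n}" "\<And>i j. i \<le> n \<Longrightarrow> j \<le> n \<Longrightarrow> (f i, f j) \<in> B \<longleftrightarrow> j = Suc i \<or> i = Suc j"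
proof -
  have f': "f 0 = x" "f n = y" "\<And>i. i < n \<Longrightarrow> (f i, f (Suc i)) \<in> B"
    using f by (auto simp: walk_through_def)
  have short: "j \<le> Suc i" if "j \<le> n" "(f i, f j) \<in> B" for i j
  proof (rule ccontr)
    assume "\<not> ?thesis"
    then show False using walk_through_shortcut[OF f _ that] min by force
  qed
  have neq: False if ij: "i < j" "j \<le> n" "f i = f j" for i j
  proof (cases "j = n")
    case True
    \<comment> \<open>No edge leaves the last vertex, so the edge entering the first occurrence is
      used; it exists because \<open>x \<noteq> y\<close>.\<close>
    then have "i \<noteq> 0" using xy ij(3) f'(1,2) by metis
    then obtain k where k: "i = Suc k" using not0_implies_Suc by blast
    then have "(f k, f j) \<in> B" using f'(3)[of k] ij by auto
    from short[OF ij(2) this] show False using ij k by simp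
  next
    case False
    then have "(f i, f (Suc j)) \<in> B" using f'(3)[of j] ij by auto
    from short[OF _ this] show False using ij False by simp
  qed
  show "inj_on f {..n}"
    by (intro inj_onI) (metis atMost_iff linorder_neqE_nat neq)
  show "(f i, f j) \<in> B \<longleftrightarrow> j = Suc i \<or> i = Suc j" if "i \<le> n" "j \<le> n" for i j
  proof
    assume ij: "(f i, f j) \<in> B"
    moreover have "(f j, f i) \<in> B" using ij B(1) by (auto dest: symD)
    ultimately have "j \<le> Suc i" "i \<le> Suc j" using short that by auto
    moreover have "i \<noteq> j" using ij B(2) by auto
    ultimately show "j = Suc i \<or> i = Suc j" by linarith
  next
    assume "j = Suc i \<or> i = Suc j"
    then show "(f i, f j) \<in> B" using f'(3)[of i] f'(3)[of j] that B(1) by (auto dest: symD)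
  qed
qed

text \<open>A shortest walk from \<open>x\<close> to \<open>y\<close> through \<open>A\<close> is
  induced and closes up at \<open>v\<close>, which has no neighbour in \<open>A\<close>. For
  nonadjacent \<open>x\<close> and \<open>y\<close> this is an induced cycle of length
  \<open>N + 2\<close>, at least four.\<close>

lemma decomposable_adjacentI:
  assumes dec: "decomposable V B" and B: "sym B" "\<And>v. (v, v) \<notin> B"
    and V: "v \<in> V" "x \<in> V" "y \<in> V" "A \<subseteq> V"
    and v: "(v, x) \<in> B" "(v, y) \<in> B" "\<And>a. a \<in> A \<Longrightarrow> a \<noteq> v \<and> (v, a) \<notin> B"
    and xy: "x \<noteq> y" and walk: "walk_through A B x y n f"
  shows "(x, y) \<in> B"
proof (rule ccontr)
  assume nadj: "(x, y) \<notin> B"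
  define N where "N = (LEAST n. \<exists>f. walk_through A B x y n f)"
  have "\<exists>f. walk_through A B x y N f" 
    unfolding N_def using walk by (intro LeastI[of "\<lambda>n. \<exists>f. walk_through A B x y n f" n] exI)
  then obtain f where f: "walk_through A B x y N f" ..
  have min: "N \<le> m" if "walk_through A B x y m g" for m g
    unfolding N_def using that by (intro Least_le[of "\<lambda>n. \<exists>f. walk_through A B x y n f"] exI)
  have inj: "inj_on f {..N}"
    by (rule shortest_walk_induced(1)[OF f min B xy])
  have adj: "(f i, f j) \<in> B \<longleftrightarrow> j = Suc i \<or> i = Suc j" if "i \<le> N" "j \<le> N" for i j
    by (rule shortest_walk_induced(2)[OF f min B xy that])
  have f': "f 0 = x" "f N = y" "\<And>i. 0 < i \<Longrightarrow> i < N \<Longrightarrow> f i \<in> A" "\<And>i. i < N \<Longrightarrow> (f i, f (Suc i)) \<in> B"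
    using f by (auto simp: walk_through_def)
  have "N \<noteq> 0" using f'(1,2) xy by metis
  moreover have "N \<noteq> 1" using f'(1,2) f'(4)[of 0] nadj by auto
  ultimately have N: "2 \<le> N" by linarith
  have fk: "f k = x \<or> f k = y \<or> f k \<in> A" if "k \<le> N" for k
    using f'(1-2) f'(3)[of k] that by (cases "k = 0"; cases "k = N") auto
  have vk: "(v, f k) \<in> B \<longleftrightarrow> k = 0 \<or> k = N" if "k \<le> N" for k
  proof -
    have "(v, f k) \<notin> B" if "0 < k" "k < N" using v(3) f'(3)[OF that] by blast
    then show ?thesis using v(1,2) f'(1,2) \<open>k \<le> N\<close> by (metis le_neq_implies_less neq0_conv)
  qed
  have vn: "v \<noteq> f k" if "k \<le> N" for k
    using fk[OF that] v B(2) by auto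
  define vs where "vs = v # map f [0..<Suc N]"
  have len: "length vs = Suc (Suc N)" by (simp add: vs_def)
  have nth: "vs ! 0 = v" "\<And>k. k \<le> N \<Longrightarrow> vs ! Suc k = f k"
    by (auto simp: vs_def nth_append less_Suc_eq_le simp del: upt_Suc)
  have "induced_cycle V B vs"
    unfolding induced_cycle_def
  proof (intro conjI allI impI)
    show "3 \<le> length vs" using N by (simp add: len)
    have "distinct (map f [0..<Suc N])"
      using inj by (simp add: distinct_map atLeast0LessThan lessThan_Suc_atMost del: upt_Suc)
    moreover have "v \<notin> set (map f [0..<Suc N])"
      using vn by (force simp: less_Suc_eq_le simp del: upt_Suc)
    ultimately show "distinct vs" by (simp add: vs_def del: upt_Suc)
    show "set vs \<subseteq> V"
    proof -
      have "f k \<in> V" if "k \<le> N" for k using fk[OF that] V by blast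
      then show ?thesis using V(1) by (auto simp: vs_def less_Suc_eq_le simp del: upt_Suc)
    qed
    fix i j assume ij: "i < length vs" "j < length vs"
    have sym: "(a, b) \<in> B \<longleftrightarrow> (b, a) \<in> B" for a b using B(1) by (auto dest: symD)
    have step: "Suc (Suc k) mod length vs = (if k = N then 0 else Suc (Suc k))" if "k \<le> N" for k
      using that by (simp add: len)
    have step0: "Suc 0 mod length vs = Suc 0" by (simp add: len)
    show "(vs ! i, vs ! j) \<in> B \<longleftrightarrow> j = Suc i mod length vs \<or> i = Suc j mod length vs"
    proof (cases i)
      case i: 0
      show ?thesis
      proof (cases j)
        case 0
        then show ?thesis using i B(2) nth step0 by simp
      next
        case (Suc l)
        then show ?thesis using i ij nth vk[of l] step[of l] step0 by (auto simp: len)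
      qed
    next
      case i: (Suc k)
      show ?thesis
      proof (cases j)
        case 0
        then show ?thesis using i ij nth vk[of k] step[of k] step0 sym[of v "f k"] by (auto simp: len)
      next
        case (Suc l)
        then show ?thesis using i ij nth adj[of k l] step[of k] step[of l] by (auto simp: len)
      qed
    qed
  qed
  moreover have "length vs > 3" using N by (simp add: len)
  ultimately show False using dec by (auto simp: decomposable_def)
qed

lemma walk_through_extend:
  assumes f: "f 0 = p" "f n = q" "\<And>i. i < n \<Longrightarrow> (f i, f (Suc i)) \<in> B" "\<And>i. i \<le> n \<Longrightarrow> f i \<in> A"
    and x: "(x, p) \<in> B" and y: "(q, y) \<in> B"
  shows "walk_through A B x y (Suc (Suc n)) (\<lambda>k. if k = 0 then x else if k = Suc (Suc n) then y else f (k - 1))"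
  unfolding walk_through_def
proof (intro conjI allI impI)
  let ?g = "\<lambda>k. if k = 0 then x else if k = Suc (Suc n) then y else f (k - 1)"
  show "(?g i, ?g (Suc i)) \<in> B" if "i < Suc (Suc n)" for i
  proof (cases i)
    case 0
    then show ?thesis using f x by simp
  next
    case (Suc k)
    show ?thesis
    proof (cases "k = n")
      case True
      then show ?thesis using f y Suc by simp
    next
      case False
      then show ?thesis using f(3)[of k] Suc that by simp
    qed
  qed
  show "?g i \<in> A" if "0 < i \<and> i < Suc (Suc n)" for i
    using f(4)[of "i - 1"] that by auto
qed simp_all

text \<open>The prescribed \<open>v\<close> makes the induction work: a simplicial vertex of a
  smaller graph must be kept out of the separator \<open>S\<close>. Here \<open>A\<close> is the
  component of \<open>u\<close> among the non-neighbours of \<open>v\<close>. Its boundary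
  \<open>S\<close> consists of neighbours of \<open>v\<close> and is therefore a clique, and
  vertices of \<open>A\<close> have all their neighbours in \<open>A \<union> S\<close>.\<close>

lemma nonadjacent_simplicial_exists:
  assumes "finite V" and B: "sym B" "\<And>v. (v, v) \<notin> B"
    and "decomposable V B" "v \<in> V" "u \<in> V" "u \<noteq> v" "(v, u) \<notin> B"
  shows "\<exists>w\<in>V. w \<noteq> v \<and> (v, w) \<notin> B \<and> simplicial V B w"
  using assms(1,4-)
proof (induction V arbitrary: v u rule: finite_psubset_induct)
  case (psubset V)
  have sym: "(b, a) \<in> B" if "(a, b) \<in> B" for a b using B(1) that by (auto dest: symD)
  define A0 where "A0 = {w \<in> V. w \<noteq> v \<and> (v, w) \<notin> B}"
  define R where "R = B \<inter> A0 \<times> A0"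
  define A where "A = R\<^sup>* `` {u}"
  have "A \<subseteq> A0"
  proof
    fix a assume "a \<in> A"
    then have "(u, a) \<in> R\<^sup>*" by (simp add: A_def)
    then show "a \<in> A0"
      using psubset.prems by (induction rule: rtrancl_induct) (auto simp: A0_def R_def)
  qed
  have uA: "u \<in> A" by (simp add: A_def)
  have step: "b \<in> A" if "a \<in> A" "(a, b) \<in> R" for a b
    using that by (auto simp: A_def intro: rtrancl_into_rtrancl)
  have AV: "A \<subseteq> V" using \<open>A \<subseteq> A0\<close> by (auto simp: A0_def)
  define S where "S = {s \<in> V - A. \<exists>a\<in>A. (s, a) \<in> B}"
  have Sv: "(v, s) \<in> B" if s: "s \<in> S" for s
  proof (rule ccontr)
    assume n: "(v, s) \<notin> B"
    obtain a where a: "a \<in> A" "(s, a) \<in> B" using s by (auto simp: S_def)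
    then have "s \<noteq> v" using \<open>A \<subseteq> A0\<close> by (auto simp: A0_def)
    then have "(a, s) \<in> R" using s n a sym \<open>A \<subseteq> A0\<close> by (auto simp: R_def S_def A0_def)
    then show False using step a s by (auto simp: S_def)
  qed
  have S_clique: "(x, y) \<in> B" if x: "x \<in> S" and y: "y \<in> S" and xy: "x \<noteq> y" for x y
  proof -
    obtain p q where p: "p \<in> A" "(x, p) \<in> B" and q: "q \<in> A" "(q, y) \<in> B"
      using x y sym by (auto simp: S_def)
    have "sym R" using B(1) by (auto simp: R_def sym_def)
    then have "(p, u) \<in> R\<^sup>*" using p(1) by (auto simp: A_def dest: symD[OF sym_rtrancl])
    then have "(p, q) \<in> R\<^sup>*" using q(1) by (auto simp: A_def)
    then obtain n f where f: "f 0 = p" "f n = q" "\<And>i. i < n \<Longrightarrow> (f i, f (Suc i)) \<in> R"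
      by (auto simp: rtrancl_is_UN_relpow relpow_fun_conv)
    have "f i \<in> A" if "i \<le> n" for i
      using that by (induction i) (use f p step in \<open>auto simp: less_eq_Suc_le\<close>)
    then have "walk_through A B x y (Suc (Suc n)) (\<lambda>k. if k = 0 then x else if k = Suc (Suc n) then y else f (k - 1))"
      using f p q by (intro walk_through_extend) (auto simp: R_def)
    then show ?thesis
      using psubset.prems x y Sv xy AV \<open>A \<subseteq> A0\<close>
      by (intro decomposable_adjacentI[of V B v x y A]) (auto simp: B S_def A0_def)
  qed
  have sub: "A \<subset> V" "A \<union> S \<subset> V"
    using AV \<open>A \<subseteq> A0\<close> \<open>v \<in> V\<close> Sv[of v] B(2) by (auto simp: A0_def S_def)
  have nb: "x \<in> A \<union> S" if "w \<in> A" "x \<in> V" "(w, x) \<in> B" for w x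
    using that sym by (auto simp: S_def)
  show ?case
  proof (cases "\<exists>s\<in>S. \<exists>a\<in>A \<union> S. a \<noteq> s \<and> (s, a) \<notin> B")
    case True
    \<comment> \<open>Induction on \<open>A \<union> S\<close> with \<open>s\<close> in the role of
      \<open>v\<close>: the vertex found is not adjacent to \<open>s\<close>, hence outside the
      clique \<open>S\<close>.\<close>
    then obtain s a where s: "s \<in> S" "a \<in> A \<union> S" "a \<noteq> s" "(s, a) \<notin> B" by blast
    have "\<exists>w\<in>A \<union> S. w \<noteq> s \<and> (s, w) \<notin> B \<and> simplicial (A \<union> S) B w"
      using psubset.prems(1) sub s by (intro psubset.IH) (auto intro: decomposable_subset)
    then obtain w where w: "w \<in> A \<union> S" "w \<noteq> s" "(s, w) \<notin> B" "simplicial (A \<union> S) B w" by blast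
    then have "w \<in> A" using S_clique s by auto
    then have "simplicial V B w" using w(4) nb unfolding simplicial_def by meson
    then show ?thesis using \<open>w \<in> A\<close> \<open>A \<subseteq> A0\<close> by (auto simp: A0_def)
  next
    case False
    \<comment> \<open>Now each vertex of \<open>S\<close> is adjacent to all others in
      \<open>A \<union> S\<close>, so a vertex that is simplicial in \<open>A\<close> remains so in
      \<open>V\<close>.\<close>
    have "\<exists>w\<in>A. simplicial A B w"
    proof (cases "\<exists>a\<in>A. \<exists>b\<in>A. b \<noteq> a \<and> (a, b) \<notin> B")
      case True
      then obtain a b where "a \<in> A" "b \<in> A" "b \<noteq> a" "(a, b) \<notin> B" by blast
      then have "\<exists>w\<in>A. w \<noteq> a \<and> (a, w) \<notin> B \<and> simplicial A B w"
        using psubset.prems(1) sub by (intro psubset.IH) (auto intro: decomposable_subset)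
      then show ?thesis by blast
    next
      case False
      then have "simplicial A B u" unfolding simplicial_def by metis
      then show ?thesis using uA by blast
    qed
    then obtain w where w: "w \<in> A" "simplicial A B w" by blast
    have "simplicial V B w"
      unfolding simplicial_def
    proof (intro ballI impI)
      fix x y assume xy: "x \<in> V" "y \<in> V" "(w, x) \<in> B \<and> (w, y) \<in> B \<and> x \<noteq> y"
      then have "x \<in> A \<union> S" "y \<in> A \<union> S" using nb w(1) by auto
      moreover have "(x, y) \<in> B" if "x \<in> A" "y \<in> A"
        using w(2) xy that by (auto simp: simplicial_def)
      moreover have "(x, y) \<in> B" if "x \<in> S" "y \<in> A \<union> S"
        using False xy that by auto
      moreover have "(x, y) \<in> B" if "y \<in> S" "x \<in> A \<union> S"
        using False xy that by (auto intro: sym)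
      ultimately show "(x, y) \<in> B" by blast
    qed
    then show ?thesis using w(1) \<open>A \<subseteq> A0\<close> by (auto simp: A0_def)
  qed
qed

lemma simplicial_exists:
  assumes "finite V" and B: "sym B" "\<And>v. (v, v) \<notin> B" and "decomposable V B" "V \<noteq> {}"
  shows "\<exists>w\<in>V. simplicial V B w"
proof (cases "\<exists>v\<in>V. \<exists>u\<in>V. u \<noteq> v \<and> (v, u) \<notin> B")
  case True
  then obtain v u where "v \<in> V" "u \<in> V" "u \<noteq> v" "(v, u) \<notin> B" by blast
  from nonadjacent_simplicial_exists[OF assms(1) B assms(4) this] show ?thesis by blast
next
  case False
  then have "simplicial V B w" for w unfolding simplicial_def by metis
  then show ?thesis using assms(5) by blast
qed

text \<open>Eliminating a simplicial vertex creates no fill-in: the cliques \<open>C\<close> support a Cholesky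
  factorization of every matrix in \<^term>\<open>PD V B\<close>.\<close>

lemma PD_clique_decomposition:
  assumes "finite V" and B: "sym B" "\<And>v. (v, v) \<notin> B" and "decomposable V B"
  shows "\<exists>C. (\<forall>v\<in>V. C v \<subseteq> V \<and> (\<forall>i\<in>C v. \<forall>j\<in>C v. i \<noteq> j \<longrightarrow> (i, j) \<in> B)) \<and>
    (\<forall>W\<in>PD V B. \<exists>t. (\<forall>v\<in>V. \<forall>i. i \<notin> C v \<longrightarrow> t v i = 0) \<and>
      (\<forall>i\<in>V. \<forall>j\<in>V. W i j = (\<Sum>v\<in>V. t v i * t v j)))"
  using assms(1,4)
proof (induction V rule: finite_psubset_induct)
  case (psubset V)
  show ?case
  proof (cases "V = {}")
    case False
    then obtain w where w: "w \<in> V" "simplicial V B w"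
      using simplicial_exists[OF psubset.hyps B psubset.prems] by blast
    define V' where "V' = V - {w}"
    have V': "V' \<subset> V" "finite V'" "w \<notin> V'" "V = insert w V'" using w psubset.hyps by (auto simp: V'_def)
    obtain C where C: "\<forall>v\<in>V'. C v \<subseteq> V' \<and> (\<forall>i\<in>C v. \<forall>j\<in>C v. i \<noteq> j \<longrightarrow> (i, j) \<in> B)"
        "\<forall>W\<in>PD V' B. \<exists>t. (\<forall>v\<in>V'. \<forall>i. i \<notin> C v \<longrightarrow> t v i = 0) \<and>
          (\<forall>i\<in>V'. \<forall>j\<in>V'. W i j = (\<Sum>v\<in>V'. t v i * t v j))"
      using psubset.IH[OF V'(1) decomposable_subset[OF psubset.prems psubset_imp_subset[OF V'(1)]]]
      by (elim exE conjE)
    \<comment> \<open>The closed neighbourhood of \<open>w\<close>. The cliques are chosen before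
      the matrix, because they become edges of one digraph that has to serve all matrices.\<close>
    define Cw where "Cw = insert w {x \<in> V. (w, x) \<in> B}"
    have Cw: "Cw \<subseteq> V" "\<And>i j. i \<in> Cw \<Longrightarrow> j \<in> Cw \<Longrightarrow> i \<noteq> j \<Longrightarrow> (i, j) \<in> B"
      using w symD[OF B(1)] by (auto simp: Cw_def simplicial_def)
    have "\<exists>t. (\<forall>v\<in>V. \<forall>i. i \<notin> (C(w := Cw)) v \<longrightarrow> t v i = 0) \<and>
      (\<forall>i\<in>V. \<forall>j\<in>V. W i j = (\<Sum>v\<in>V. t v i * t v j))" if W: "W \<in> PD V B" for W
    proof -
      have WP: "sym_pos_def V W" and W0: "\<And>i j. i \<in> V \<Longrightarrow> j \<in> V \<Longrightarrow> i \<noteq> j \<Longrightarrow> (i, j) \<notin> B \<Longrightarrow> W i j = 0"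
        using W by (auto simp: PD_def)
      have Ws: "W i j = W j i" if "i \<in> V" "j \<in> V" for i j using sym_pos_def_sym[OF WP that] .
      have ww: "W w w > 0"
      proof -
        have "bil V W (\<lambda>k. if k = w then 1 else 0) (\<lambda>k. if k = w then 1 else 0) > 0"
          using WP w(1) unfolding sym_pos_def_bil by auto
        then show ?thesis using bil_indicator[OF psubset.hyps w(1) w(1)] by simp
      qed
      \<comment> \<open>The Cholesky column of \<open>w\<close>; \<open>W'\<close> is the Schur
        complement. Subtracting the product changes off-diagonal entries only inside the clique
        \<open>Cw\<close>, where \<open>B\<close> allows nonzero values.\<close>
      define t0 where "t0 i = (if i \<in> Cw then W w i / sqrt (W w w) else 0)" for i
      have t0: "t0 i = W w i / sqrt (W w w)" if "i \<in> V" for i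
        using that W0[OF w(1) that] by (auto simp: t0_def Cw_def)
      have t00: "t0 i * t0 j = W w i * W w j / W w w" if "i \<in> V" "j \<in> V" for i j
        using ww by (simp add: t0[OF that(1)] t0[OF that(2)])
      define W' where "W' i j = W i j - t0 i * t0 j" for i j
      have "W' \<in> PD V' B"
        unfolding PD_def sym_pos_def_bil
      proof (intro CollectI conjI ballI allI impI)
        fix i j assume ij: "i \<in> V'" "j \<in> V'"
        then show "W' i j = W' j i" using Ws[of i j] V' by (auto simp: W'_def)
        assume n: "i \<noteq> j \<and> (i, j) \<notin> B"
        then have "i \<notin> Cw \<or> j \<notin> Cw" using Cw by auto
        then show "W' i j = 0" using n W0[of i j] ij V' by (auto simp: W'_def t0_def)
      next
        fix x assume x: "\<exists>i\<in>V'. x i \<noteq> (0 :: real)"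
        define s where "s = (\<Sum>k\<in>V'. W w k * x k)"
        \<comment> \<open>The value at \<open>w\<close> minimizes the form of \<open>W\<close> over
          that coordinate; the minimum is the form of the Schur complement.\<close>
        define z where "z = x(w := - s / W w w)"
        have zV': "z k = x k" if "k \<in> V'" for k using that V' by (auto simp: z_def)
        have s': "(\<Sum>k\<in>V'. W w k * z k) = s" "(\<Sum>k\<in>V'. z k * W k w) = s"
          unfolding s_def using zV' Ws w V' by (auto intro!: sum.cong simp: mult.commute)
        have "bil V W z z = bil V' W z z - s\<^sup>2 / W w w"
          unfolding V'(4) bil_insert[OF V'(2,3)] s' using ww by (simp add: z_def power2_eq_square)
        also have "bil V' W z z = bil V' W x x"
          using zV' by (intro bil_cong) auto
        also have "bil V' W x x - s\<^sup>2 / W w w = bil V' W' x x"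
        proof -
          have "(\<Sum>j\<in>V'. W' i j * x j) = (\<Sum>j\<in>V'. W i j * x j) - W w i * s / W w w" if "i \<in> V'" for i
          proof -
            have "(\<Sum>j\<in>V'. W' i j * x j) = (\<Sum>j\<in>V'. W i j * x j - W w i / W w w * (W w j * x j))"
              using that V' t00 by (intro sum.cong) (auto simp: W'_def left_diff_distrib)
            then show ?thesis by (simp add: s_def sum_subtractf sum_distrib_left sum_divide_distrib)
          qed
          then have "bil V' W' x x = (\<Sum>i\<in>V'. x i * ((\<Sum>j\<in>V'. W i j * x j) - W w i * s / W w w))"
            unfolding bil_alt by (intro sum.cong) auto
          also have "\<dots> = bil V' W x x - (\<Sum>i\<in>V'. (W w i * x i) * (s / W w w))"
            by (simp add: bil_alt right_diff_distrib sum_subtractf mult_ac)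
          also have "(\<Sum>i\<in>V'. (W w i * x i) * (s / W w w)) = s\<^sup>2 / W w w"
            unfolding sum_distrib_right[symmetric] by (simp add: s_def[symmetric] power2_eq_square)
          finally show ?thesis by simp
        qed
        finally have "bil V W z z = bil V' W' x x" .
        moreover have "\<exists>i\<in>V. z i \<noteq> 0" using x zV' V' by auto
        ultimately show "bil V' W' x x > 0" using WP unfolding sym_pos_def_bil by metis
      qed
      then obtain t where t: "\<forall>v\<in>V'. \<forall>i. i \<notin> C v \<longrightarrow> t v i = 0"
          "\<forall>i\<in>V'. \<forall>j\<in>V'. W' i j = (\<Sum>v\<in>V'. t v i * t v j)"
        using C(2) by (elim ballE[of _ _ W'] exE conjE) auto
      have tw: "t v w = 0" if "v \<in> V'" for v using t(1) C(1) that V'(3) by blast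
      have "W i j = (\<Sum>v\<in>V. (t(w := t0)) v i * (t(w := t0)) v j)" if ij: "i \<in> V" "j \<in> V" for i j
      proof -
        have "(\<Sum>v\<in>V. (t(w := t0)) v i * (t(w := t0)) v j) = t0 i * t0 j + (\<Sum>v\<in>V'. t v i * t v j)"
          unfolding V'(4) using V'(2,3) by (subst sum.insert) (auto intro!: sum.cong)
        also have "\<dots> = W i j"
        proof (cases "i = w \<or> j = w")
          case True
          then have "(\<Sum>v\<in>V'. t v i * t v j) = 0" using tw by (intro sum.neutral) auto
          moreover have "t0 i * t0 j = W i j" using True t00[OF ij] ww Ws[OF ij] by auto
          ultimately show ?thesis by simp
        next
          case False
          then have "W' i j = (\<Sum>v\<in>V'. t v i * t v j)" using t(2) ij V'(4) by auto
          then show ?thesis by (simp add: W'_def)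
        qed
        finally show ?thesis by simp
      qed
      moreover have "\<forall>v\<in>V. \<forall>i. i \<notin> (C(w := Cw)) v \<longrightarrow> (t(w := t0)) v i = 0"
        using t(1) V'(4) by (auto simp: t0_def)
      ultimately show ?thesis by (intro exI[of _ "t(w := t0)"] conjI) blast+
    qed
    moreover have "\<forall>v\<in>V. (C(w := Cw)) v \<subseteq> V \<and> (\<forall>i\<in>(C(w := Cw)) v. \<forall>j\<in>(C(w := Cw)) v. i \<noteq> j \<longrightarrow> (i, j) \<in> B)"
      using C(1) Cw V' by auto
    ultimately show ?thesis by (intro exI[of _ "C(w := Cw)"] conjI) blast+
  qed auto
qed

section \<open>Chain graphs with decomposable bidirected part\<close>

lemma chain_graph_no_return:
  assumes G: "chain_graph V D B" and xy: "(x, y) \<in> D" and yx: "(y, x) \<in> (D \<union> B)\<^sup>*"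
  shows False
proof -
  obtain n f where f: "f 0 = y" "f n = x" "\<And>i. i < n \<Longrightarrow> (f i, f (Suc i)) \<in> D \<union> B"
    using yx by (auto simp: rtrancl_is_UN_relpow relpow_fun_conv)
  \<comment> \<open>The list runs from \<open>y\<close> to \<open>x\<close>, so the wrap-around edge
    is \<open>(x, y)\<close>.\<close>
  define vs where "vs = map f [0..<Suc n]"
  have len: "length vs = Suc n" by (simp add: vs_def)
  have nth: "vs ! i = f i" if "i \<le> n" for i
    using that by (simp add: vs_def less_Suc_eq_le del: upt_Suc)
  have "semi_directed_cycle D B vs"
    unfolding semi_directed_cycle_def
  proof (intro conjI allI impI)
    fix i assume "i < length vs"
    then show "(vs ! i, vs ! (Suc i mod length vs)) \<in> D \<union> B"
      using f nth xy by (cases "i = n") (auto simp: len)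
  next
    have "(vs ! n, vs ! (Suc n mod length vs)) \<in> D" using f nth xy by (simp add: len)
    then show "\<exists>i<length vs. (vs ! i, vs ! (Suc i mod length vs)) \<in> D" by (auto simp: len)
  qed
  then show False using G by (auto simp: chain_graph_def)
qed

lemma chain_graph_acyclic_digraph:
  assumes "chain_graph V D B"
  shows "acyclic_digraph V D"
proof -
  have "acyclic D"
  proof (rule acyclicI, intro allI notI)
    fix x assume "(x, x) \<in> D\<^sup>+"
    then obtain y where "(x, y) \<in> D" "(y, x) \<in> D\<^sup>*" by (meson tranclD)
    then show False using chain_graph_no_return[OF assms] rtrancl_mono[of D "D \<union> B"] by blast
  qed
  then show ?thesis using assms by (auto simp: chain_graph_def mixed_graph_def acyclic_digraph_def)
qed

text \<open>No edge enters \<open>H\<close>, so an edge of \<open>F\<close> can only be the first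
  edge of a path, and a cycle would already be a cycle of \<open>D\<close>.\<close>

lemma acyclic_digraph_add_sources:
  assumes D: "acyclic_digraph V D" and H: "finite H" "H \<inter> V = {}" and F: "F \<subseteq> H \<times> V"
  shows "acyclic_digraph (V \<union> H) (D \<union> F)"
proof -
  have DV: "D \<subseteq> V \<times> V" and V: "finite V" and ac: "acyclic D" using D by (auto simp: acyclic_digraph_def)
  have "y \<in> V \<and> (x \<in> V \<longrightarrow> (x, y) \<in> D\<^sup>+)" if "(x, y) \<in> (D \<union> F)\<^sup>+" for x y
    using that
  proof (induction rule: trancl_induct)
    case (base y)
    then show ?case using DV F H by auto
  next
    case (step y z)
    then have "(y, z) \<in> D" "z \<in> V" using DV F H by auto
    then show ?case using step.IH by (auto intro: trancl_into_trancl)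
  qed
  then have "acyclic (D \<union> F)" using ac unfolding acyclic_def by blast
  then show ?thesis using DV V H F by (auto simp: acyclic_digraph_def)
qed

text \<open>Sources \<open>H\<close> that are marginalized out only enter the error covariance of the \<open>V\<close>
  equations; \<open>G u k\<close> is the coefficient of the error \<open>\<epsilon>\<^sub>u\<close> in the equation of \<open>k\<close>.\<close>

lemma sem_cov_add_sources:
  assumes D: "acyclic_digraph V D" and H: "finite H" "H \<inter> V = {}" and F: "F \<subseteq> H \<times> V"
    and L: "supported_on (V \<union> H) (D \<union> F) L" and W: "W \<in> pos_diag (V \<union> H)"
    and ij: "i \<in> V" "j \<in> V"
  defines "G \<equiv> \<lambda>u k. if u \<in> V then idm u k else L u k"
  shows "sem_cov (V \<union> H) L W i j = sem_cov V L (\<lambda>k l. \<Sum>u\<in>V \<union> H. W u u * G u k * G u l) i j"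
proof -
  let ?U = "V \<union> H"
  have DV: "D \<subseteq> V \<times> V" and V: "finite V" using D by (auto simp: acyclic_digraph_def)
  have U: "finite ?U" using V H by simp
  have LV: "supported_on V D L" using L F H by (auto simp: supported_on_def)
  have LH: "L k h = 0" if "k \<in> ?U" "h \<in> H" for k h
  proof -
    have "(k, h) \<notin> D \<union> F" using F H DV that by blast
    then show ?thesis using L that by (auto simp: supported_on_def)
  qed
  define M where "M = minv V (\<lambda>i j. idm i j - L i j)"
  define N where "N = minv ?U (\<lambda>i j. idm i j - L i j)"
  have M: "is_minv V (\<lambda>i j. idm i j - L i j) M"
    unfolding M_def by (rule acyclic_digraph_invertible[OF D LV])
  have N: "is_minv ?U (\<lambda>i j. idm i j - L i j) N"
    unfolding N_def by (rule acyclic_digraph_invertible[OF acyclic_digraph_add_sources[OF D H F] L])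
  \<comment> \<open>A source equals its own error.\<close>
  have NH: "N u h = idm u h" if "u \<in> ?U" "h \<in> H" for u h
    using minv_fixpoint[OF U N, of u h] that LH by simp
  have NG: "N u i = G u i + (\<Sum>k\<in>V. N u k * L k i)" if "u \<in> ?U" "i \<in> V" for u i
  proof -
    have "(\<Sum>k\<in>?U. N u k * L k i) = (\<Sum>k\<in>V. N u k * L k i) + (\<Sum>k\<in>H. N u k * L k i)"
      using V H by (intro sum.union_disjoint) auto
    also have "(\<Sum>k\<in>H. N u k * L k i) = (\<Sum>k\<in>H. idm u k * L k i)"
      using NH that by (intro sum.cong) auto
    also have "\<dots> = (if u \<in> H then L u i else 0)"
      using H by (simp add: idm_def if_distrib if_distribR cong: if_cong)
    finally show ?thesis
      using minv_fixpoint[OF U N, of u i] that H by (auto simp: G_def idm_def)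
  qed
  \<comment> \<open>By \<open>NG\<close> the columns in \<open>V\<close> satisfy
    \<open>N (I - L) = G\<close>; multiplying by \<open>M\<close> from the right gives
    \<open>N = G M\<close>.\<close>
  have GM: "(\<Sum>k\<in>V. G u k * M k i) = N u i" if u: "u \<in> ?U" and i: "i \<in> V" for u i
  proof -
    have "G u k = (\<Sum>l\<in>V. N u l * (idm l k - L l k))" if "k \<in> V" for k
    proof -
      have "(\<Sum>l\<in>V. N u l * idm l k) = N u k"
        using V that by (simp add: idm_def if_distrib if_distribR cong: if_cong)
      then show ?thesis using NG[OF u that] by (simp add: right_diff_distrib sum_subtractf)
    qed
    then have "(\<Sum>k\<in>V. G u k * M k i) = (\<Sum>k\<in>V. (\<Sum>l\<in>V. N u l * (idm l k - L l k)) * M k i)"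
      by (intro sum.cong) auto
    also have "\<dots> = bil V (\<lambda>i j. idm i j - L i j) (N u) (\<lambda>k. M k i)"
      by (simp add: bil_alt')
    also have "\<dots> = N u i" by (rule bil_minv_col[OF V M i])
    finally show ?thesis .
  qed
  have "sem_cov ?U L W i j = (\<Sum>u\<in>?U. W u u * N u i * N u j)"
    unfolding sem_cov_eq bil_pos_diag[OF U W] N_def ..
  also have "\<dots> = (\<Sum>u\<in>?U. W u u * (\<Sum>k\<in>V. G u k * M k i) * (\<Sum>k\<in>V. G u k * M k j))"
    using GM ij by (intro sum.cong) auto
  finally show ?thesis
    unfolding sem_cov_eq M_def[symmetric] bil_sum_squares .
qed

text \<open>Off-diagonal entries come only from hidden sources with two children, which are adjacent
  in \<open>B\<close>. Definiteness comes from the errors of \<open>V\<close> themselves, which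
  enter with coefficient \<open>1\<close>.\<close>

lemma clique_sources_PD:
  assumes V: "finite V" and H: "finite H" "H \<inter> V = {}" and W: "W \<in> pos_diag (V \<union> H)"
    and clique: "\<And>u i j. u \<in> H \<Longrightarrow> i \<in> V \<Longrightarrow> j \<in> V \<Longrightarrow> L u i \<noteq> 0 \<Longrightarrow> L u j \<noteq> 0 \<Longrightarrow> i \<noteq> j \<Longrightarrow> (i, j) \<in> B"
  defines "G \<equiv> \<lambda>u k. if u \<in> V then idm u k else L u k"
  shows "(\<lambda>k l. \<Sum>u\<in>V \<union> H. W u u * G u k * G u l) \<in> PD V B"
  unfolding PD_def sym_pos_def_bil
proof (intro CollectI conjI ballI allI impI)
  show "(\<Sum>u\<in>V \<union> H. W u u * G u i * G u j) = (\<Sum>u\<in>V \<union> H. W u u * G u j * G u i)" for i j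
    by (simp add: mult_ac)
next
  fix i j assume ij: "i \<in> V" "j \<in> V" and n: "i \<noteq> j \<and> (i, j) \<notin> B"
  have "G u i * G u j = 0" if "u \<in> V \<union> H" for u
    using clique[of u i j] n ij that by (auto simp: G_def idm_def)
  then show "(\<Sum>u\<in>V \<union> H. W u u * G u i * G u j) = 0"
    by (intro sum.neutral) (simp add: mult.assoc)
next
  have W0: "W u u > 0" if "u \<in> V \<union> H" for u using W that by (simp add: pos_diag_def)
  fix x assume "\<exists>i\<in>V. x i \<noteq> (0::real)"
  then obtain i where i: "i \<in> V" "x i \<noteq> 0" by blast
  have "(\<Sum>k\<in>V. G i k * x k) = (\<Sum>k\<in>V. if k = i then x i else 0)"
    using i by (intro sum.cong) (auto simp: G_def idm_def)
  then have "(\<Sum>k\<in>V. G i k * x k) = x i" using V i by simp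
  moreover have "0 < W i i * (x i)\<^sup>2" using i W0[of i] by (intro mult_pos_pos) auto
  ultimately have "0 < W i i * (\<Sum>k\<in>V. G i k * x k) * (\<Sum>k\<in>V. G i k * x k)"
    by (simp add: power2_eq_square mult.assoc)
  moreover have "0 \<le> W u u * (\<Sum>k\<in>V. G u k * x k) * (\<Sum>k\<in>V. G u k * x k)" if "u \<in> V \<union> H" for u
    using W0[OF that] by (simp add: mult.assoc)
  ultimately show "bil V (\<lambda>k l. \<Sum>u\<in>V \<union> H. W u u * G u k * G u l) x x > 0"
    unfolding bil_sum_squares using V H i by (intro sum_pos2[of "V \<union> H" i]) auto
qed

text \<open>The number \<open>e\<close> serves twice: as the variance left to the own error of each
  vertex of \<open>V\<close> in the digraph, and as the amount by which the diagonal of the cycle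
  matrix is lowered.\<close>

lemma PD_subtract_identity:
  assumes V: "finite V" and W: "W \<in> PD V B"
  obtains e where "e > 0" "(\<lambda>i j. W i j - e * idm i j) \<in> PD V B"
proof -
  have S: "sym_pos_def V W" using W by (simp add: PD_def)
  from sym_pos_def_lower_bound[OF V S] obtain e where
    e: "e > 0" "\<And>x. (\<exists>i\<in>V. x i \<noteq> 0) \<Longrightarrow> bil V W x x > e * (\<Sum>i\<in>V. (x i)\<^sup>2)" by metis
  have "bil V (\<lambda>i j. W i j - e * idm i j) x x = bil V W x x - e * (\<Sum>i\<in>V. (x i)\<^sup>2)" for x
  proof -
    have "(\<Sum>j\<in>V. (W i j - e * idm i j) * x j) = (\<Sum>j\<in>V. W i j * x j) - e * x i" if "i \<in> V" for i
    proof -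
      have "(\<Sum>j\<in>V. e * (idm i j * x j)) = e * x i"
        using V that by (simp add: idm_def if_distrib if_distribR cong: if_cong)
      then show ?thesis by (simp add: left_diff_distrib sum_subtractf mult.assoc)
    qed
    then have "bil V (\<lambda>i j. W i j - e * idm i j) x x = (\<Sum>i\<in>V. x i * ((\<Sum>j\<in>V. W i j * x j) - e * x i))"
      unfolding bil_alt by (intro sum.cong) auto
    then show ?thesis
      by (simp add: bil_alt right_diff_distrib sum_subtractf sum_distrib_left power2_eq_square mult_ac)
  qed
  then have "(\<lambda>i j. W i j - e * idm i j) \<in> PD V B"
    using W e(2) unfolding PD_def sym_pos_def_bil by (auto simp: idm_def)
  then show thesis using e(1) that by blast
qed

text \<open>Supplies a hidden source \<open>h v\<close> for the clique of each vertex
  \<open>v\<close>.\<close>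

lemma ex_inj_disjoint:
  fixes V :: "('a::infinite) set"
  assumes "finite V"
  obtains h :: "'a \<Rightarrow> 'a" where "inj_on h V" "h ` V \<inter> V = {}"
proof -
  have "infinite (- V)" using assms by (simp add: infinite_UNIV Compl_eq_Diff_UNIV)
  then obtain X where X: "finite X" "card X = card V" "X \<subseteq> - V"
    using infinite_arbitrarily_large by metis
  obtain h where h: "bij_betw h V X"
    using finite_same_card_bij[OF assms X(1)] X(2) by auto
  show thesis using X(3) h by (intro that[of h]) (auto simp: bij_betw_def)
qed

lemma decomposable_imp_strictly_gaussian_causal:
  fixes V :: "('a::infinite) set"
  assumes G: "chain_graph V D B" and dec: "decomposable V B"
  shows "strictly_gaussian_causal V D B"
proof -
  have V: "finite V" and DV: "D \<subseteq> V \<times> V" and B: "sym B" "\<And>v. (v, v) \<notin> B"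
    using G by (auto simp: chain_graph_def mixed_graph_def)
  have D: "acyclic_digraph V D" by (rule chain_graph_acyclic_digraph[OF G])
  obtain h :: "'a \<Rightarrow> 'a" where h: "inj_on h V" "h ` V \<inter> V = {}" using ex_inj_disjoint[OF V] .
  obtain C where C: "\<forall>v\<in>V. C v \<subseteq> V \<and> (\<forall>i\<in>C v. \<forall>j\<in>C v. i \<noteq> j \<longrightarrow> (i, j) \<in> B)"
    "\<forall>W\<in>PD V B. \<exists>t. (\<forall>v\<in>V. \<forall>i. i \<notin> C v \<longrightarrow> t v i = 0) \<and>
      (\<forall>i\<in>V. \<forall>j\<in>V. W i j = (\<Sum>v\<in>V. t v i * t v j))"
    using PD_clique_decomposition[OF V B dec] by (elim exE conjE)
  define H where "H = h ` V"
  define F where "F = {(h v, i) | v i. v \<in> V \<and> i \<in> C v}"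
  have H: "finite H" "H \<inter> V = {}" using V h by (auto simp: H_def)
  have F: "F \<subseteq> H \<times> V" using C(1) by (auto simp: F_def H_def)
  let ?U = "V \<union> H" and ?E = "D \<union> F"
  have UE: "acyclic_digraph ?U ?E" by (rule acyclic_digraph_add_sources[OF D H F])
  have U: "finite ?U" using V H by simp
  define \<Omega> where "\<Omega> L W = (\<lambda>k l. \<Sum>u\<in>?U. W u u * (if u \<in> V then idm u k else L u k) * (if u \<in> V then idm u l else L u l))"
    for L W :: "'a rmat"
  have marg: "marginal V (mvn ?U \<mu> (sem_cov ?U L W)) = mvn V \<mu> (sem_cov V L (\<Omega> L W))"
    if L: "supported_on ?U ?E L" and W: "W \<in> pos_diag ?U" for \<mu> L W
  proof -
    have "marginal V (mvn ?U \<mu> (sem_cov ?U L W)) = mvn V \<mu> (sem_cov ?U L W)"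
      by (rule marginal_mvn[OF U _ sem_cov_sym_pos_def[OF UE L pos_diag_sym_pos_def[OF U W]]]) auto
    also have "\<dots> = mvn V \<mu> (sem_cov V L (\<Omega> L W))"
      using sem_cov_add_sources[OF D H F L W] by (intro mvn_cong) (simp add: mat_eq_def \<Omega>_def)
    finally show ?thesis .
  qed
  have "marginal V ` digraph_model ?U ?E = mixed_graph_model V D B"
  proof (intro equalityI subsetI)
    fix X assume "X \<in> marginal V ` digraph_model ?U ?E"
    then obtain \<mu> L W where L: "supported_on ?U ?E L" and W: "W \<in> pos_diag ?U"
        and X: "X = marginal V (mvn ?U \<mu> (sem_cov ?U L W))"
      by (auto simp: digraph_model_def)
    have "(i, j) \<in> B"
      if u: "u \<in> H" and ij: "i \<in> V" "j \<in> V" "L u i \<noteq> 0" "L u j \<noteq> 0" "i \<noteq> j" for u i j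
    proof -
      obtain v where v: "v \<in> V" "u = h v" using u by (auto simp: H_def)
      have "(u, i) \<in> F" "(u, j) \<in> F"
        using L u ij DV H by (auto simp: supported_on_def)
      then have "i \<in> C v" "j \<in> C v"
        using v h(1) by (auto simp: F_def dest: inj_onD)
      then show ?thesis using C(1) v ij by blast
    qed
    then have "\<Omega> L W \<in> PD V B"
      unfolding \<Omega>_def by (intro clique_sources_PD V H W) auto
    moreover have "supported_on V D L" using L F H by (auto simp: supported_on_def)
    ultimately show "X \<in> mixed_graph_model V D B"
      unfolding X marg[OF L W] mixed_graph_model_def by blast
  next
    fix X assume "X \<in> mixed_graph_model V D B"
    then obtain \<mu> L W where L: "supported_on V D L" and W: "W \<in> PD V B"
        and X: "X = mvn V \<mu> (sem_cov V L W)"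
      by (auto simp: mixed_graph_model_def)
    obtain e where e: "e > 0" "(\<lambda>i j. W i j - e * idm i j) \<in> PD V B"
      using PD_subtract_identity[OF V W] .
    obtain t where t: "\<forall>v\<in>V. \<forall>i. i \<notin> C v \<longrightarrow> t v i = 0"
        "\<forall>i\<in>V. \<forall>j\<in>V. W i j - e * idm i j = (\<Sum>v\<in>V. t v i * t v j)"
      using bspec[OF C(2) e(2)] by (elim exE conjE)
    define L' where "L' a b = (if a \<in> V \<and> b \<in> V then L a b
        else if a \<in> H \<and> b \<in> V then t (inv_into V h a) b else 0)" for a b
    \<comment> \<open>Hidden errors have variance \<open>1\<close>, so the source \<open>h v\<close>
      contributes exactly the rank one matrix of \<open>t v\<close>; the errors of \<open>V\<close>
      contribute \<open>e\<close> times the identity.\<close>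
    define W' where "W' a b = (if a = b then if a \<in> V then e else 1 else (0::real))" for a b :: 'a
    have L'h: "L' (h v) i = t v i" if "v \<in> V" "i \<in> V" for v i
      using that H h(1) by (auto simp: L'_def H_def)
    have L': "supported_on ?U ?E L'"
      unfolding supported_on_def
    proof (intro ballI impI)
      fix a b assume a: "a \<in> ?U" and b: "b \<in> ?U" and ab: "(a, b) \<notin> ?E"
      show "L' a b = 0"
      proof (cases "a \<in> H \<and> b \<in> V")
        case True
        then obtain v where v: "v \<in> V" "a = h v" by (auto simp: H_def)
        then have "b \<notin> C v" using ab by (auto simp: F_def)
        then show ?thesis using v t(1) L'h[of v b] True by auto
      next
        case False
        then show ?thesis using L ab by (auto simp: L'_def supported_on_def)
      qed
    qed
    have W': "W' \<in> pos_diag ?U" using e by (auto simp: pos_diag_def W'_def)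
    have "\<Omega> L' W' i j = W i j" if ij: "i \<in> V" "j \<in> V" for i j
    proof -
      have "\<Omega> L' W' i j = (\<Sum>u\<in>V. W' u u * idm u i * idm u j) + (\<Sum>u\<in>H. W' u u * L' u i * L' u j)"
        unfolding \<Omega>_def using V H by (subst sum.union_disjoint) (auto intro!: sum.cong arg_cong2[of _ _ _ _ "(+)"])
      also have "(\<Sum>u\<in>V. W' u u * idm u i * idm u j) = (\<Sum>u\<in>V. if u = i then e * idm i j else 0)"
        by (intro sum.cong) (auto simp: W'_def idm_def)
      also have "\<dots> = e * idm i j" using V ij by simp
      also have "(\<Sum>u\<in>H. W' u u * L' u i * L' u j) = (\<Sum>v\<in>V. W' (h v) (h v) * L' (h v) i * L' (h v) j)"
        unfolding H_def using h(1) by (simp add: sum.reindex)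
      also have "\<dots> = (\<Sum>v\<in>V. t v i * t v j)"
        using H ij L'h by (intro sum.cong) (auto simp: W'_def H_def)
      also have "\<dots> = W i j - e * idm i j" using t(2) ij by simp
      finally show ?thesis by simp
    qed
    then have "mat_eq V (sem_cov V L' (\<Omega> L' W')) (sem_cov V L W)"
      by (intro sem_cov_cong) (auto simp: mat_eq_def L'_def)
    then have "X = marginal V (mvn ?U \<mu> (sem_cov ?U L' W'))"
      unfolding X marg[OF L' W'] by (rule mvn_cong[OF mat_eq_sym])
    then show "X \<in> marginal V ` digraph_model ?U ?E"
      using L' W' unfolding digraph_model_def by blast
  qed
  then show ?thesis unfolding strictly_gaussian_causal_def using UE by blast
qed

section \<open>Necessity of decomposability\<close>

text \<open>Let \<open>C\<close> lie in one bidirected component and let \<open>P\<close> be its parents. The minor of the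
  covariance matrix with rows \<open>a, P\<close> and columns \<open>b, P\<close> is the conditional covariance of \<open>a\<close> and
  \<open>b\<close> given \<open>P\<close>, up to the factor \<open>mdet P\<close>, and this conditional covariance is the error
  covariance \<open>W a b\<close>. A fixed vertex \<open>z\<close> of \<open>C\<close> serves as the index of the extra row and
  column.\<close>

lemma mdet_parents_minor:
  assumes G: "chain_graph V D B" and C: "C \<subseteq> V" "\<And>a b. a \<in> C \<Longrightarrow> b \<in> C \<Longrightarrow> (a, b) \<in> B\<^sup>*"
    and L: "supported_on V D L" and W: "W \<in> PD V B"
    and z: "z \<in> C" and ab: "a \<in> C" "b \<in> C"
  defines "P \<equiv> {p. \<exists>c\<in>C. (p, c) \<in> D}" and "S \<equiv> sem_cov V L W"
  shows "z \<notin> P"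
    "mdet (insert z P) (\<lambda>i j. S ((id(z := a)) i) ((id(z := b)) j)) = W a b * mdet P S"
proof -
  have V: "finite V" and DV: "D \<subseteq> V \<times> V"
    using G by (auto simp: chain_graph_def mixed_graph_def)
  have PV: "P \<subseteq> V" and P: "finite P" using DV V by (auto simp: P_def intro: finite_subset)
  have D: "acyclic_digraph V D" by (rule chain_graph_acyclic_digraph[OF G])
  define M where "M = minv V (\<lambda>i j. idm i j - L i j)"
  have M: "is_minv V (\<lambda>i j. idm i j - L i j) M"
    unfolding M_def by (rule acyclic_digraph_invertible[OF D L])
  \<comment> \<open>A walk from \<open>c\<close> to a parent \<open>p\<close> would continue along
    the edge from \<open>p\<close> to its child in \<open>C\<close> and return to \<open>c\<close>
    inside the bidirected component, closing a semi-directed cycle.\<close>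
  have noret: "(c, p) \<notin> (D \<union> B)\<^sup>*" if c: "c \<in> C" and p: "p \<in> P" for c p
  proof
    assume cp: "(c, p) \<in> (D \<union> B)\<^sup>*"
    obtain c' where c': "c' \<in> C" "(p, c') \<in> D" using p by (auto simp: P_def)
    then have "(c', c) \<in> (D \<union> B)\<^sup>*"
      using C(2)[of c' c] c rtrancl_mono[of B "D \<union> B"] by blast
    then have "(c', p) \<in> (D \<union> B)\<^sup>*" using cp by (rule rtrancl_trans)
    then show False using chain_graph_no_return[OF G c'(2)] by blast
  qed
  show zP: "z \<notin> P" using noret[OF z, of z] by auto
  have LP: "L p c = 0" if "p \<in> V" "c \<in> C" "p \<notin> P" for p c
    using L that C(1) by (auto simp: supported_on_def P_def)
  have sumP: "(\<Sum>p\<in>V. g p * L p c) = (\<Sum>p\<in>P. g p * L p c)" if "c \<in> C" for g c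
    using V PV LP that by (intro sum.mono_neutral_right) auto
  \<comment> \<open>The covariance of the error of \<open>c\<close> with the variable
    \<open>j\<close>. It vanishes at parents by \<open>noret\<close>, so the structural equation of
    \<open>c'\<close> leaves only \<open>W c c'\<close>.\<close>
  define E where "E c j = (\<Sum>k\<in>V. W c k * M k j)" for c j
  have EP: "E c p = 0" if c: "c \<in> C" and p: "p \<in> P" for c p
    unfolding E_def
  proof (intro sum.neutral ballI)
    fix k assume k: "k \<in> V"
    show "W c k * M k p = 0"
    proof (rule ccontr)
      assume nz: "W c k * M k p \<noteq> 0"
      have "(k, p) \<in> D\<^sup>*"
        using minv_reachable[OF D L M k, of p] nz p PV by auto
      then have "(k, p) \<in> (D \<union> B)\<^sup>*" using rtrancl_mono[of D "D \<union> B"] by blast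
      moreover have "c = k \<or> (c, k) \<in> B"
        using W nz c C(1) k by (auto simp: PD_def)
      then have "(c, k) \<in> (D \<union> B)\<^sup>*" by auto
      ultimately have "(c, p) \<in> (D \<union> B)\<^sup>*" by (meson rtrancl_trans)
      then show False using noret c p by blast
    qed
  qed
  have EC: "E c c' = W c c'" if c: "c \<in> C" "c' \<in> C" for c c'
  proof -
    have c'V: "c' \<in> V" using c C by auto
    have "E c c' = (\<Sum>k\<in>V. W c k * idm k c') + (\<Sum>k\<in>V. W c k * (\<Sum>p\<in>P. M k p * L p c'))"
      unfolding E_def sum.distrib[symmetric] sumP[OF c(2), symmetric]
      using minv_fixpoint[OF V M _ c'V] by (intro sum.cong) (auto simp: distrib_left)
    also have "(\<Sum>k\<in>V. W c k * idm k c') = W c c'"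
      using V c'V by (simp add: idm_def if_distrib cong: if_cong)
    also have "(\<Sum>k\<in>V. W c k * (\<Sum>p\<in>P. M k p * L p c')) = (\<Sum>p\<in>P. E c p * L p c')"
      unfolding E_def sum_distrib_left sum_distrib_right mult.assoc by (rule sum.swap)
    also have "\<dots> = 0" using EP c by simp
    finally show ?thesis by simp
  qed
  \<comment> \<open>The structural equation of \<open>c\<close>, paired with the variable
    \<open>j\<close>.\<close>
  have SE: "S c j = E c j + (\<Sum>p\<in>P. L p c * S p j)" if c: "c \<in> C" for c j
  proof -
    have cV: "c \<in> V" using c C by auto
    let ?F = "\<lambda>k. \<Sum>l\<in>V. W k l * M l j"
    have S: "S i j = (\<Sum>k\<in>V. M k i * ?F k)" for i
      by (simp add: S_def sem_cov_eq M_def bil_alt)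
    have "S c j = (\<Sum>k\<in>V. idm k c * ?F k) + (\<Sum>k\<in>V. (\<Sum>p\<in>P. M k p * L p c) * ?F k)"
      unfolding S sum.distrib[symmetric] sumP[OF c, symmetric]
      using minv_fixpoint[OF V M _ cV] by (intro sum.cong) (auto simp: distrib_right)
    also have "(\<Sum>k\<in>V. idm k c * ?F k) = E c j"
      using V cV by (simp add: idm_def E_def if_distrib if_distribR cong: if_cong)
    also have "(\<Sum>k\<in>V. (\<Sum>p\<in>P. M k p * L p c) * ?F k) = (\<Sum>p\<in>P. \<Sum>k\<in>V. (M k p * L p c) * ?F k)"
      unfolding sum_distrib_right by (rule sum.swap)
    also have "\<dots> = (\<Sum>p\<in>P. L p c * S p j)"
      unfolding S sum_distrib_left by (intro sum.cong) (simp_all add: mult_ac)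
    finally show ?thesis .
  qed
  let ?Q = "insert z P"
  define N where "N = (\<lambda>i j. S ((id(z := a)) i) ((id(z := b)) j))"
  \<comment> \<open>Subtracting the rows of the parents with the coefficients of \<open>a\<close>
    turns row \<open>z\<close> into \<open>E a\<close>, which is zero in the columns
    \<open>P\<close>.\<close>
  define cf where "cf k = (if k = z then 1 else - L k a)" for k
  define N' where "N' = N(z := (\<lambda>j. \<Sum>k\<in>?Q. cf k * N k j))"
  have Nz: "N' z j = E a ((id(z := b)) j)" for j
  proof -
    have "N' z j = N z j + (\<Sum>k\<in>P. cf k * N k j)"
      using P zP by (simp add: N'_def cf_def)
    also have "(\<Sum>k\<in>P. cf k * N k j) = - (\<Sum>p\<in>P. L p a * S p ((id(z := b)) j))"
      unfolding sum_negf[symmetric] using zP by (intro sum.cong) (auto simp: cf_def N_def)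
    also have "N z j = S a ((id(z := b)) j)" by (simp add: N_def)
    finally show ?thesis using SE[OF ab(1), of "(id(z := b)) j"] by simp
  qed
  have "mdet ?Q N = mdet ?Q N'"
    using mdet_row_combination[of ?Q z N cf] P by (simp add: N'_def cf_def)
  also have "\<dots> = N' z z * mdet P N'"
    using zP EP[OF ab(1)] by (intro mdet_insert_row_zero[OF P zP]) (auto simp: Nz)
  also have "N' z z = W a b" unfolding Nz using EC[OF ab] by simp
  also have "mdet P N' = mdet P S"
    using zP by (intro mdet_cong) (auto simp: mat_eq_def N'_def N_def)
  finally show "mdet ?Q (\<lambda>i j. S ((id(z := a)) i) ((id(z := b)) j)) = W a b * mdet P S"
    by (simp add: N_def)
qed

text \<open>The coefficient of the monomial of a set \<open>S\<close> of errors in the minor: letting the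
  variances outside \<open>S\<close> tend to zero leaves only the injective \<open>f\<close> with image \<open>S\<close>, whose
  contributions agree.\<close>

lemma minor_coefficient_zero:
  assumes Q: "finite Q" and U: "finite U" and f: "f \<in> Q \<rightarrow>\<^sub>E U"
    and 0: "\<And>w. (\<And>u. u \<in> U \<Longrightarrow> w u > 0) \<Longrightarrow> mdet Q (\<lambda>i j. \<Sum>u\<in>U. w u * X u i * Y u j) = 0"
  shows "mdet Q (\<lambda>i j. X (f i) j) * mdet Q (\<lambda>i j. Y (f i) j) = 0"
proof -
  define F where "F = Q \<rightarrow>\<^sub>E U"
  define g where "g f = mdet Q (\<lambda>i j. X (f i) j) * mdet Q (\<lambda>i j. Y (f i) j)" for f :: "_ \<Rightarrow> _"
  have F: "finite F" unfolding F_def using Q U by (simp add: finite_PiE)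
  have noninj: "g h = 0" if "\<not> inj_on h Q" for h
  proof -
    obtain i k where "i \<in> Q" "k \<in> Q" "i \<noteq> k" "h i = h k" using \<open>\<not> inj_on h Q\<close> by (auto simp: inj_on_def)
    then have "mdet Q (\<lambda>i j. X (h i) j) = 0" by (intro mdet_identical_rows[OF Q, of i k]) auto
    then show ?thesis by (simp add: g_def)
  qed
  \<comment> \<open>Variance \<open>1\<close> on the image of \<open>f\<close> and \<open>s\<close>
    elsewhere. Variances are positive, so \<open>s = 0\<close> is reached only as a limit.\<close>
  define \<phi> where "\<phi> s = (\<Sum>h\<in>F. (\<Prod>i\<in>Q. if h i \<in> f ` Q then 1 else s) * g h)" for s :: real
  have "\<phi> s = 0" if "s > 0" for s
    using Cauchy_Binet[OF Q U, of "\<lambda>u. if u \<in> f ` Q then 1 else s" X Y] 0[of "\<lambda>u. if u \<in> f ` Q then 1 else s"] that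
    by (simp add: \<phi>_def F_def g_def mult.assoc)
  moreover have "(\<phi> \<longlongrightarrow> \<phi> 0) (at_right 0)"
    unfolding \<phi>_def by (intro tendsto_intros tendsto_eq_intros) auto
  ultimately have "((\<lambda>_. 0) \<longlongrightarrow> \<phi> 0) (at_right (0::real))"
    by (elim Lim_transform_eventually) (auto simp: eventually_at_right_less eventually_at_topological intro: eventually_at_rightI[of 0 1])
  then have \<phi>0: "\<phi> 0 = 0" by (simp add: tendsto_const_iff)
  show ?thesis
  proof (cases "inj_on f Q")
    case inj: True
    \<comment> \<open>On \<open>Q\<close>, \<open>h\<close> is \<open>f\<close> after a permutation,
      whose sign enters both minors and cancels.\<close>
    have geq: "g h = g f" if h: "inj_on h Q" "h ` Q \<subseteq> f ` Q" for h
    proof -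
      define \<pi> where "\<pi> i = (if i \<in> Q then inv_into Q f (h i) else i)" for i
      have "h ` Q = f ` Q"
        using h inj Q by (intro card_subset_eq) (auto simp: card_image)
      then have "bij_betw h Q (f ` Q)" using h by (auto simp: bij_betw_def)
      moreover have "bij_betw (inv_into Q f) (f ` Q) Q"
        using inj by (intro bij_betw_inv_into) (auto simp: bij_betw_def)
      ultimately have "bij_betw (inv_into Q f \<circ> h) Q Q" by (rule bij_betw_trans)
      then have "bij_betw \<pi> Q Q" by (rule bij_betw_cong[THEN iffD1, rotated]) (auto simp: \<pi>_def)
      then have \<pi>: "\<pi> permutes Q" by (intro bij_imp_permutes) (auto simp: \<pi>_def)
      have f\<pi>: "f (\<pi> i) = h i" if "i \<in> Q" for i
        using that h(2) by (auto simp: \<pi>_def intro!: f_inv_into_f)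
      have "mdet Q (\<lambda>i j. Z (h i) j) = of_int (sign \<pi>) * mdet Q (\<lambda>i j. Z (f i) j)" for Z :: "_ \<Rightarrow> _ \<Rightarrow> real"
        using mdet_permute_rows[OF Q \<pi>, of "\<lambda>i j. Z (f i) j"] f\<pi>
          mdet_cong[of Q "\<lambda>i j. Z (f (\<pi> i)) j" "\<lambda>i j. Z (h i) j"]
        by (simp add: mat_eq_def)
      note * = this[of X] this[of Y]
      have "g h = (of_int (sign \<pi>) * of_int (sign \<pi>)) * g f"
        unfolding g_def * by (simp only: mult_ac)
      also have "of_int (sign \<pi>) * of_int (sign \<pi>) = (1::real)"
        using sign_idempotent[of \<pi>] by (metis of_int_1 of_int_mult)
      finally show ?thesis by simp
    qed
    \<comment> \<open>Multiplied by \<open>g f\<close>, every term is nonnegative, so the term of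
      \<open>f\<close> alone is at most zero. This replaces counting the maps with the same
      image.\<close>
    have "0 = \<phi> 0 * g f" by (simp add: \<phi>0)
    also have "\<dots> = (\<Sum>h\<in>F. (\<Prod>i\<in>Q. if h i \<in> f ` Q then 1 else 0) * (g h * g f))"
      by (simp add: \<phi>_def sum_distrib_right mult.assoc)
    also have "\<dots> \<ge> (\<Prod>i\<in>Q. if f i \<in> f ` Q then 1 else 0) * (g f * g f)"
    proof (rule member_le_sum)
      fix h assume "h \<in> F - {f}"
      show "0 \<le> (\<Prod>i\<in>Q. if h i \<in> f ` Q then 1 else 0) * (g h * g f)"
      proof (cases "h ` Q \<subseteq> f ` Q \<and> inj_on h Q")
        case True
        then have "g h = g f" by (intro geq) auto
        then have "0 \<le> g h * g f" by simp
        then show ?thesis by (rule mult_nonneg_nonneg[rotated]) (auto intro: prod_nonneg)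
      next
        case False
        then have "g h = 0 \<or> (\<exists>i\<in>Q. h i \<notin> f ` Q)" using noninj by auto
        then show ?thesis
        proof
          assume "\<exists>i\<in>Q. h i \<notin> f ` Q"
          then have "(\<Prod>i\<in>Q. if h i \<in> f ` Q then 1 else (0::real)) = 0" using Q by auto
          then show ?thesis by simp
        qed simp
      qed
    qed (use f F in \<open>auto simp: F_def\<close>)
    finally have "g f * g f \<le> 0" by simp
    then have "(g f)\<^sup>2 \<le> 0" by (simp add: power2_eq_square)
    then have "g f = 0" by simp
    then show ?thesis by (simp add: g_def)
  next
    case False
    then show ?thesis using noninj by (simp add: g_def)
  qed
qed

text \<open>At most one edge of a cycle of length at least four lies in the support of a vector that
  is supported on a clique.\<close>

lemma cycle_clique_vector:
  fixes f \<sigma> :: "nat \<Rightarrow> real" and n :: nat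
  defines "s \<equiv> \<lambda>k. if Suc k = n then 0 else Suc k"
  assumes n: "n > 3" and \<sigma>: "\<And>k. \<bar>\<sigma> k\<bar> = 1"
    and 0: "\<And>k l. k < n \<Longrightarrow> l < n \<Longrightarrow> k \<noteq> l \<Longrightarrow> l \<noteq> s k \<Longrightarrow> k \<noteq> s l \<Longrightarrow> f k * f l = 0"
  shows "(\<Sum>k<n. 2 * \<sigma> k * (f k * f (s k))) \<le> (\<Sum>k<n. (f k)\<^sup>2)"
proof (cases "\<exists>k<n. f k * f (s k) \<noteq> 0")
  case False
  then have "(\<Sum>k<n. 2 * \<sigma> k * (f k * f (s k))) = 0" by (intro sum.neutral) auto
  then show ?thesis by (simp add: sum_nonneg)
next
  case True
  then obtain k where k: "k < n" "f k \<noteq> 0" "f (s k) \<noteq> 0" by auto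
  have sk: "s k < n" "s k \<noteq> k" using k n by (auto simp: s_def)
  have f0: "f l = 0" if "l < n" "l \<noteq> k" "l \<noteq> s k" for l
  proof (rule ccontr)
    assume l: "f l \<noteq> 0"
    \<comment> \<open>A third vertex \<open>l\<close> of the support would be adjacent to both
      \<open>k\<close> and \<open>s k\<close>, which is possible only in a cycle of length
      three.\<close>
    have "k = s l" using 0[of k l] k l that by auto
    moreover have "s k \<noteq> s l" using that by (auto simp: s_def split: if_splits)
    then have "l = s (s k)" using 0[of "s k" l] k(3) sk l that by auto
    ultimately show False using k n by (auto simp: s_def split: if_splits)
  qed
  have "(\<Sum>l<n. 2 * \<sigma> l * (f l * f (s l))) = (\<Sum>l\<in>{k}. 2 * \<sigma> l * (f l * f (s l)))"
  proof (intro sum.mono_neutral_right ballI)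
    fix l assume l: "l \<in> {..<n} - {k}"
    have "s l < n" using l n by (auto simp: s_def)
    have "s (s k) \<noteq> k" "s (s k) \<noteq> s k" using k n by (auto simp: s_def)
    then have "f l = 0 \<or> f (s l) = 0"
      using f0[of l] f0[of "s l"] l \<open>s l < n\<close> by auto
    then show "2 * \<sigma> l * (f l * f (s l)) = 0" by auto
  qed (use k in auto)
  also have "\<dots> = 2 * \<sigma> k * (f k * f (s k))" by simp
  also have "\<dots> \<le> (f k)\<^sup>2 + (f (s k))\<^sup>2"
  proof -
    have "2 * \<sigma> k * (f k * f (s k)) \<le> \<bar>2 * \<sigma> k * (f k * f (s k))\<bar>" by simp
    also have "\<dots> = 2 * \<bar>f k\<bar> * \<bar>f (s k)\<bar>" using \<sigma>[of k] by (simp add: abs_mult)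
    also have "\<dots> \<le> (f k)\<^sup>2 + (f (s k))\<^sup>2" using sum_squares_bound[of "\<bar>f k\<bar>" "\<bar>f (s k)\<bar>"] by simp
    finally show ?thesis .
  qed
  also have "\<dots> = (\<Sum>l\<in>{k, s k}. (f l)\<^sup>2)" using sk by simp
  also have "\<dots> \<le> (\<Sum>l<n. (f l)\<^sup>2)" using k sk by (intro sum_mono2) auto
  finally show ?thesis .
qed

text \<open>The quadratic form \<open>\<Sum>k<n. (x\<^sub>k + \<sigma>\<^sub>k x\<^sub>k\<^sub>+\<^sub>1)\<^sup>2\<close> is definite because an odd number of the
  signs \<open>- \<sigma>\<^sub>k\<close> is negative.\<close>

lemma cycle_matrix:
  fixes c :: "nat \<Rightarrow> 'a" and n :: nat
  defines "s \<equiv> \<lambda>k. if Suc k = n then 0 else Suc k" and "\<sigma> \<equiv> \<lambda>k. if Suc k = n then 1 else (-1::real)"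
  assumes V: "finite V" and n: "n > 3" and c: "inj_on c {..<n}" "c ` {..<n} \<subseteq> V"
    and B: "\<And>k. k < n \<Longrightarrow> (c k, c (s k)) \<in> B" "sym B"
  shows "\<exists>W e. W \<in> PD V B \<and> e > 0 \<and>
    (\<forall>k<n. W (c k) (c k) = 2 - e) \<and> (\<forall>k<n. W (c k) (c (s k)) = \<sigma> k)"
proof -
  \<comment> \<open>On the cycle the diagonal is \<open>2\<close> because each vertex occurs in two
    of the squares; off the cycle the \<open>2\<close> keeps the matrix definite.\<close>
  define R where "R = (\<lambda>i j. 2 * idm i j +
    (\<Sum>k<n. \<sigma> k * (idm i (c k) * idm j (c (s k)) + idm i (c (s k)) * idm j (c k))))"
  have s: "s k < n" if "k < n" for k using that n by (auto simp: s_def)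
  have s2: "s k \<noteq> k" "s (s k) \<noteq> k" if "k < n" for k using that n by (auto simp: s_def)
  have bij: "bij_betw s {..<n} {..<n}"
  proof (rule bij_betwI[where g = "\<lambda>k. if k = 0 then n - 1 else k - 1"])
    show "s \<in> {..<n} \<rightarrow> {..<n}" using s by auto
  qed (use n in \<open>auto simp: s_def split: if_splits\<close>)
  have cV: "c k \<in> V" if "k < n" for k using c(2) that by auto
  have ceq: "c k = c l \<longleftrightarrow> k = l" if "k < n" "l < n" for k l
    using c(1) that by (auto dest: inj_onD)
  have bilR: "bil V R x x = 2 * (\<Sum>i\<in>V - c ` {..<n}. (x i)\<^sup>2) + (\<Sum>k<n. (x (c k) + \<sigma> k * x (c (s k)))\<^sup>2)" for x
  proof -
    have ind: "(\<Sum>i\<in>V. x i * idm i a) = x a" if "a \<in> V" for a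
      using V that by (simp add: idm_def if_distrib cong: if_cong)
    have "bil V R x x = (\<Sum>i\<in>V. \<Sum>j\<in>V. 2 * (x i * (x j * idm j i)) +
        (\<Sum>k<n. \<sigma> k * ((x i * idm i (c k)) * (x j * idm j (c (s k))) + (x i * idm i (c (s k))) * (x j * idm j (c k)))))"
      unfolding bil_def R_def
      by (intro sum.cong refl) (simp add: algebra_simps sum_distrib_left, simp add: idm_def)
    also have "\<dots> = 2 * (\<Sum>i\<in>V. x i * (\<Sum>j\<in>V. x j * idm j i)) +
        (\<Sum>i\<in>V. \<Sum>j\<in>V. \<Sum>k<n. \<sigma> k * ((x i * idm i (c k)) * (x j * idm j (c (s k))) + (x i * idm i (c (s k))) * (x j * idm j (c k))))"
      by (simp add: sum.distrib sum_distrib_left)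
    also have "(\<Sum>i\<in>V. x i * (\<Sum>j\<in>V. x j * idm j i)) = (\<Sum>i\<in>V. (x i)\<^sup>2)"
      using ind by (intro sum.cong) (auto simp: power2_eq_square)
    also have "(\<Sum>i\<in>V. \<Sum>j\<in>V. \<Sum>k<n. \<sigma> k * ((x i * idm i (c k)) * (x j * idm j (c (s k))) + (x i * idm i (c (s k))) * (x j * idm j (c k))))
      = (\<Sum>k<n. \<sigma> k * ((\<Sum>i\<in>V. x i * idm i (c k)) * (\<Sum>j\<in>V. x j * idm j (c (s k))) +
          (\<Sum>i\<in>V. x i * idm i (c (s k))) * (\<Sum>j\<in>V. x j * idm j (c k))))" (is "?lhs = ?rhs")
    proof -
      have "?lhs = (\<Sum>i\<in>V. \<Sum>k<n. \<Sum>j\<in>V. \<sigma> k * ((x i * idm i (c k)) * (x j * idm j (c (s k))) + (x i * idm i (c (s k))) * (x j * idm j (c k))))"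
        by (intro sum.cong refl sum.swap)
      also have "\<dots> = (\<Sum>k<n. \<Sum>i\<in>V. \<Sum>j\<in>V. \<sigma> k * ((x i * idm i (c k)) * (x j * idm j (c (s k))) + (x i * idm i (c (s k))) * (x j * idm j (c k))))"
        by (rule sum.swap)
      also have "\<dots> = ?rhs"
        by (intro sum.cong refl) (simp only: sum_product, simp add: distrib_left sum.distrib sum_distrib_left)
      finally show ?thesis .
    qed
    also have "\<dots> = (\<Sum>k<n. 2 * (x (c k) * (\<sigma> k * x (c (s k)))))"
      using ind cV s by (intro sum.cong) auto
    also have "(\<Sum>i\<in>V. (x i)\<^sup>2) = (\<Sum>i\<in>V - c ` {..<n}. (x i)\<^sup>2) + (\<Sum>k<n. (x (c k))\<^sup>2)"
      using sum.subset_diff[OF c(2) V, of "\<lambda>i. (x i)\<^sup>2"] c(1) by (simp add: sum.reindex)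
    finally have "bil V R x x = 2 * (\<Sum>i\<in>V - c ` {..<n}. (x i)\<^sup>2) + 2 * (\<Sum>k<n. (x (c k))\<^sup>2)
        + (\<Sum>k<n. 2 * (x (c k) * (\<sigma> k * x (c (s k)))))" by simp
    moreover have "(\<Sum>k<n. (x (c (s k)))\<^sup>2) = (\<Sum>k<n. (x (c k))\<^sup>2)"
      by (rule sum.reindex_bij_betw[OF bij])
    moreover have "(x (c k) + \<sigma> k * x (c (s k)))\<^sup>2 = (x (c k))\<^sup>2 + (x (c (s k)))\<^sup>2 + 2 * (x (c k) * (\<sigma> k * x (c (s k))))" for k
      by (simp add: \<sigma>_def power2_eq_square algebra_simps)
    ultimately show ?thesis by (simp add: sum.distrib)
  qed
  have "R \<in> PD V B"
    unfolding PD_def sym_pos_def_bil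
  proof (intro CollectI conjI ballI allI impI)
    show "R i j = R j i" for i j
      by (simp add: R_def mult.commute add.commute idm_def)
  next
    fix i j assume "i \<in> V" "j \<in> V" "i \<noteq> j \<and> (i, j) \<notin> B"
    then have "\<sigma> k * (idm i (c k) * idm j (c (s k)) + idm i (c (s k)) * idm j (c k)) = 0" if "k < n" for k
      using B(1)[OF that] symD[OF B(2) B(1)[OF that]] by (auto simp: idm_def)
    then have "(\<Sum>k<n. \<sigma> k * (idm i (c k) * idm j (c (s k)) + idm i (c (s k)) * idm j (c k))) = 0"
      by (intro sum.neutral) blast
    moreover have "idm i j = 0" using \<open>i \<noteq> j \<and> (i, j) \<notin> B\<close> by (simp add: idm_def)
    ultimately show "R i j = 0" by (simp add: R_def)
  next
    fix x assume ex: "\<exists>i\<in>V. x i \<noteq> (0::real)"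
    let ?d = "\<lambda>k. x (c k) + \<sigma> k * x (c (s k))"
    let ?S1 = "\<Sum>i\<in>V - c ` {..<n}. (x i)\<^sup>2" and ?S2 = "\<Sum>k<n. (?d k)\<^sup>2"
    have nn: "?S1 \<ge> 0" "?S2 \<ge> 0" by (auto intro: sum_nonneg)
    show "bil V R x x > 0"
    proof (rule ccontr)
      assume "\<not> ?thesis"
      then have "?S1 = 0" "?S2 = 0" using nn bilR[of x] by linarith+
      then have "\<forall>i\<in>V - c ` {..<n}. (x i)\<^sup>2 = 0" "\<forall>k\<in>{..<n}. (?d k)\<^sup>2 = 0"
        using V by (simp_all add: sum_nonneg_eq_0_iff)
      then have off: "\<And>i. i \<in> V - c ` {..<n} \<Longrightarrow> x i = 0" and d: "\<And>k. k < n \<Longrightarrow> ?d k = 0"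
        by auto
      \<comment> \<open>All squares but the last force consecutive coordinates to agree; the last
        then forces \<open>x (c 0) = - x (c 0)\<close>.\<close>
      have eq: "x (c k) = x (c 0)" if "k < n" for k
        using that
      proof (induction k)
        case (Suc k)
        then have "x (c k) = x (c (Suc k))" using d[of k] by (simp add: \<sigma>_def s_def)
        then show ?case using Suc by simp
      qed simp
      have "x (c (n - 1)) = - x (c 0)" using d[of "n - 1"] n by (simp add: \<sigma>_def s_def)
      then have "x (c 0) = 0" using eq[of "n - 1"] n by simp
      then have "x i = 0" if "i \<in> V" for i using that off[of i] eq by (cases "i \<in> c ` {..<n}") auto
      then show False using ex by blast
    qed
  qed
  from PD_subtract_identity[OF V this] obtain e where e: "e > 0" "(\<lambda>i j. R i j - e * idm i j) \<in> PD V B" .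
  have "R (c k) (c k) - e * idm (c k) (c k) = 2 - e \<and> R (c k) (c (s k)) - e * idm (c k) (c (s k)) = \<sigma> k"
    if k: "k < n" for k
  proof
    have "idm (c k) (c m) * idm (c k) (c (s m)) = 0" if "m < n" for m
      using k that s[OF that] s2[OF that] by (auto simp: idm_def ceq)
    then have "(\<Sum>m<n. \<sigma> m * (idm (c k) (c m) * idm (c k) (c (s m)) + idm (c k) (c (s m)) * idm (c k) (c m))) = 0"
      by (intro sum.neutral) (auto simp: mult.commute)
    then show "R (c k) (c k) - e * idm (c k) (c k) = 2 - e"
      by (simp add: R_def idm_def)
    \<comment> \<open>A match with the edge reversed would need \<open>s (s k) = k\<close>.\<close>
    have "\<sigma> m * (idm (c k) (c m) * idm (c (s k)) (c (s m)) + idm (c k) (c (s m)) * idm (c (s k)) (c m)) =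
        (if m = k then \<sigma> k else 0)" if "m < n" for m
      using k that s[OF that] s[OF k] s2[OF that] s2[OF k] by (auto simp: idm_def ceq)
    then have "(\<Sum>m<n. \<sigma> m * (idm (c k) (c m) * idm (c (s k)) (c (s m)) + idm (c k) (c (s m)) * idm (c (s k)) (c m)))
       = (\<Sum>m<n. if m = k then \<sigma> k else 0)"
      by (intro sum.cong) auto
    also have "\<dots> = \<sigma> k" using k by simp
    finally show "R (c k) (c (s k)) - e * idm (c k) (c (s k)) = \<sigma> k"
      using ceq[of k "s k"] s2[OF k] s[OF k] k by (simp add: R_def idm_def)
  qed
  with e show ?thesis by (intro exI[of _ "\<lambda>i j. R i j - e * idm i j"] exI[of _ e]) simp
qed

lemma strictly_gaussian_causal_imp_decomposable:
  fixes V :: "('a::infinite) set"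
  assumes G: "chain_graph V D B" and causal: "strictly_gaussian_causal V D B"
  shows "decomposable V B"
proof (rule ccontr)
  assume "\<not> ?thesis"
  then obtain vs where cyc: "induced_cycle V B vs" and len: "length vs > 3"
    by (auto simp: decomposable_def)
  have V: "finite V" and DV: "D \<subseteq> V \<times> V" and B: "sym B"
    using G by (auto simp: chain_graph_def mixed_graph_def)
  have D: "acyclic_digraph V D" by (rule chain_graph_acyclic_digraph[OF G])
  define n where "n = length vs"
  define c where "c k = vs ! k" for k
  define s where "s k = (if Suc k = n then 0 else Suc k)" for k
  define \<sigma> where "\<sigma> k = (if Suc k = n then 1 else (-1::real))" for k
  define C where "C = c ` {..<n}"
  have n: "n > 3" using len by (simp add: n_def)
  have s: "s k < n" if "k < n" for k using that n by (auto simp: s_def)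
  have c: "inj_on c {..<n}" "c ` {..<n} \<subseteq> V"
    using cyc by (auto simp: induced_cycle_def c_def n_def inj_on_def nth_eq_iff_index_eq)
  have CV: "C \<subseteq> V" using c by (simp add: C_def)
  have adj: "(c k, c l) \<in> B \<longleftrightarrow> l = s k \<or> k = s l" if "k < n" "l < n" for k l
  proof -
    have "Suc k mod n = s k" "Suc l mod n = s l" using that by (auto simp: s_def)
    then show ?thesis using cyc that unfolding induced_cycle_def c_def n_def[symmetric] by metis
  qed
  have conn: "(a, b) \<in> B\<^sup>*" if "a \<in> C" "b \<in> C" for a b
  proof -
    have "(c 0, c k) \<in> B\<^sup>*" if "k < n" for k
      using that
    proof (induction k)
      case (Suc k)
      then have "(c k, c (Suc k)) \<in> B" using adj[of k "Suc k"] by (simp add: s_def)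
      then show ?case using Suc by (auto intro: rtrancl_into_rtrancl)
    qed simp
    then have "(c 0, a) \<in> B\<^sup>*" "(c 0, b) \<in> B\<^sup>*" using that by (auto simp: C_def)
    then show ?thesis using symD[OF sym_rtrancl[OF B], of "c 0" a] by (meson rtrancl_trans)
  qed
  have "(c k, c (s k)) \<in> B" if "k < n" for k using adj[of k "s k"] s[OF that] that by blast
  then have "\<exists>W e. W \<in> PD V B \<and> e > 0 \<and>
    (\<forall>k<n. W (c k) (c k) = 2 - e) \<and> (\<forall>k<n. W (c k) (c (s k)) = \<sigma> k)"
    unfolding s_def \<sigma>_def by (rule cycle_matrix[OF V n c _ B])
  then obtain W e where W: "W \<in> PD V B" and e: "e > 0" and Wd: "\<forall>k<n. W (c k) (c k) = 2 - e"
    and We: "\<forall>k<n. W (c k) (c (s k)) = \<sigma> k"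
    by (elim exE conjE)
  obtain U E where UE: "acyclic_digraph U E" and VU: "V \<subseteq> U"
    and eq: "marginal V ` digraph_model U E = mixed_graph_model V D B"
    using causal by (auto simp: strictly_gaussian_causal_def)
  have U: "finite U" using UE by (simp add: acyclic_digraph_def)
  define z where "z = c 0"
  define P where "P = {p. \<exists>c\<in>C. (p, c) \<in> D}"
  define Q where "Q = insert z P"
  have z: "z \<in> C" using n by (auto simp: z_def C_def)
  have PV: "P \<subseteq> V" using DV by (auto simp: P_def)
  have P: "finite P" and Q: "finite Q" using PV V by (auto simp: Q_def intro: finite_subset)
  define r where "r a = id(z := a)" for a :: 'a
  have rV: "r a i \<in> V" if "a \<in> C" "i \<in> Q" for a i
    using that PV CV by (auto simp: r_def Q_def)
  have match: "mat_eq V (sem_cov U L W1) (sem_cov V L2 W2)"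
    if "supported_on U E L" "W1 \<in> pos_diag U" "supported_on V D L2" "W2 \<in> PD V B"
      "marginal V (mvn U \<mu> (sem_cov U L W1)) = mvn V \<mu>2 (sem_cov V L2 W2)" for L W1 L2 W2 \<mu> \<mu>2
  proof -
    have S: "sym_pos_def U (sem_cov U L W1)"
      by (rule sem_cov_sym_pos_def[OF UE that(1) pos_diag_sym_pos_def[OF U that(2)]])
    have "sym_pos_def V (sem_cov V L2 W2)"
      using that(4) by (intro sem_cov_sym_pos_def[OF D that(3)]) (simp add: PD_def)
    then show ?thesis
      using that(5) unfolding marginal_mvn[OF U VU S]
      by (intro mvn_inject[OF V sym_pos_def_subset[OF U VU S]])
  qed
  have zero: "supported_on V D (\<lambda>_ _. 0)" by (simp add: supported_on_def)
  have "mvn V (\<lambda>_. 0) (sem_cov V (\<lambda>_ _. 0) W) \<in> mixed_graph_model V D B"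
    unfolding mixed_graph_model_def using zero W by blast
  then have "mvn V (\<lambda>_. 0) (sem_cov V (\<lambda>_ _. 0) W) \<in> marginal V ` digraph_model U E"
    using eq by simp
  \<comment> \<open>The matrix \<open>L\<close> that realizes \<open>W\<close> stays fixed from here
    on; below only the variances are varied.\<close>
  then obtain \<mu> L W1 where L: "supported_on U E L" and W1: "W1 \<in> pos_diag U"
    and m1: "marginal V (mvn U \<mu> (sem_cov U L W1)) = mvn V (\<lambda>_. 0) (sem_cov V (\<lambda>_ _. 0) W)"
    unfolding digraph_model_def by force
  define T where "T = minv U (\<lambda>i j. idm i j - L i j)"
  \<comment> \<open>The map \<open>f\<close> stands for a set of errors: repetitions give a zero
    minor, and reorderings change only signs, which cancel in
    \<open>\<tau> f a * \<tau> f b\<close>.\<close>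
  define \<tau> where "\<tau> f a = mdet Q (\<lambda>i j. T (f i) (r a j))" for f a
  define F where "F w a b = mdet Q (\<lambda>i j. \<Sum>u\<in>U. w u * T u (r a i) * T u (r b j))" for w a b
  have minor: "F w a b = W2 a b * mdet P (sem_cov V L2 W2)"
    if W': "W' \<in> pos_diag U" "\<And>u. u \<in> U \<Longrightarrow> w u = W' u u"
      and L2: "supported_on V D L2" and W2: "W2 \<in> PD V B" and ab: "a \<in> C" "b \<in> C"
      and m: "mat_eq V (sem_cov U L W') (sem_cov V L2 W2)" for w W' L2 W2 a b
  proof -
    have "sem_cov V L2 W2 (r a i) (r b j) = (\<Sum>u\<in>U. w u * T u (r a i) * T u (r b j))"
      if "i \<in> Q" "j \<in> Q" for i j
      using mat_eqD[OF m rV[OF ab(1) that(1)] rV[OF ab(2) that(2)]] W'(2)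
      unfolding sem_cov_eq[of U] bil_pos_diag[OF U W'(1)] T_def by simp
    then have "F w a b = mdet Q (\<lambda>i j. sem_cov V L2 W2 (r a i) (r b j))"
      unfolding F_def by (intro mdet_cong) (simp add: mat_eq_def)
    also have "\<dots> = W2 a b * mdet P (sem_cov V L2 W2)"
      unfolding Q_def P_def r_def by (rule mdet_parents_minor(2)[OF G CV conn L2 W2 z ab])
    finally show ?thesis .
  qed
  have "\<tau> f a * \<tau> f b = 0"
    if f: "f \<in> Q \<rightarrow>\<^sub>E U" and ab: "a \<in> C" "b \<in> C" "a \<noteq> b" "(a, b) \<notin> B" for f a b
    unfolding \<tau>_def
  proof (rule minor_coefficient_zero[OF Q U f])
    \<comment> \<open>The other inclusion: for every choice of variances the marginal lies in the
      mixed model, so its error covariance vanishes at \<open>a\<close> and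
      \<open>b\<close>.\<close>
    fix w :: "'a \<Rightarrow> real" assume w: "\<And>u. u \<in> U \<Longrightarrow> w u > 0"
    define W' where "W' = (\<lambda>i j. if i = j then w i else 0)"
    have W': "W' \<in> pos_diag U" using w by (auto simp: pos_diag_def W'_def)
    have "mvn U (\<lambda>_. 0) (sem_cov U L W') \<in> digraph_model U E"
      unfolding digraph_model_def using L W' by blast
    then have "marginal V (mvn U (\<lambda>_. 0) (sem_cov U L W')) \<in> mixed_graph_model V D B"
      using eq by blast
    then obtain \<mu>2 L2 W2 where L2: "supported_on V D L2" and W2: "W2 \<in> PD V B"
      and m2: "marginal V (mvn U (\<lambda>_. 0) (sem_cov U L W')) = mvn V \<mu>2 (sem_cov V L2 W2)"
      unfolding mixed_graph_model_def by blast
    have "F w a b = W2 a b * mdet P (sem_cov V L2 W2)"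
      by (rule minor[OF W' _ L2 W2 ab(1,2) match[OF L W' L2 W2 m2]]) (simp add: W'_def)
    also have "W2 a b = 0" using W2 ab CV by (auto simp: PD_def)
    finally show "mdet Q (\<lambda>i j. \<Sum>u\<in>U. w u * T u (r a i) * T u (r b j)) = 0"
      by (simp add: F_def)
  qed
  then have \<tau>0: "\<tau> f (c k) * \<tau> f (c l) = 0"
    if "f \<in> Q \<rightarrow>\<^sub>E U" "k < n" "l < n" "k \<noteq> l" "l \<noteq> s k" "k \<noteq> s l" for f k l
    using that adj[of k l] inj_onD[OF c(1), of k l] by (auto simp: C_def)
  define S where "S = sem_cov V (\<lambda>_ _. 0) W"
  define K where "K = fact (card Q) * mdet P S"
  define \<omega> where "\<omega> f = (\<Prod>i\<in>Q. W1 (f i) (f i))" for f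
  have "sym_pos_def V S"
    unfolding S_def using W by (intro sem_cov_sym_pos_def[OF D zero]) (simp add: PD_def)
  then have "mdet P S > 0" by (intro sym_pos_def_mdet_pos[OF P] sym_pos_def_subset[OF V PV])
  then have K: "K > 0" by (simp add: K_def)
  have \<omega>: "\<omega> f \<ge> 0" if "f \<in> Q \<rightarrow>\<^sub>E U" for f
    unfolding \<omega>_def using W1 that by (intro prod_nonneg) (auto simp: pos_diag_def PiE_iff intro: less_imp_le)
  have KW: "K * W a b = (\<Sum>f\<in>Q \<rightarrow>\<^sub>E U. \<omega> f * (\<tau> f a * \<tau> f b))" if ab: "a \<in> C" "b \<in> C" for a b
  proof -
    have "F (\<lambda>u. W1 u u) a b = W a b * mdet P S"
      unfolding S_def by (rule minor[OF W1 refl zero W ab match[OF L W1 zero W m1]])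
    then have "K * W a b = fact (card Q) * F (\<lambda>u. W1 u u) a b" by (simp add: K_def)
    also have "\<dots> = (\<Sum>f\<in>Q \<rightarrow>\<^sub>E U. \<omega> f * (\<tau> f a * \<tau> f b))"
      unfolding F_def Cauchy_Binet[OF Q U] by (simp add: \<omega>_def \<tau>_def mult.assoc)
    finally show ?thesis .
  qed
  have cC: "c k \<in> C" if "k < n" for k using that by (auto simp: C_def)
  \<comment> \<open>The signs of the edge entries are squared away, so the edges contribute
    \<open>2 n K\<close>, while the diagonal contributes only \<open>(2 - e) n K\<close>.\<close>
  have "2 * real n * K = (\<Sum>k<n. 2 * K)" by simp
  also have "\<dots> = (\<Sum>k<n. 2 * \<sigma> k * (K * W (c k) (c (s k))))"
    using We by (intro sum.cong) (auto simp: \<sigma>_def)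
  also have "\<dots> = (\<Sum>k<n. \<Sum>f\<in>Q \<rightarrow>\<^sub>E U. \<omega> f * (2 * \<sigma> k * (\<tau> f (c k) * \<tau> f (c (s k)))))"
    using KW[OF cC cC[OF s]] by (intro sum.cong) (auto simp: sum_distrib_left mult_ac)
  also have "\<dots> = (\<Sum>f\<in>Q \<rightarrow>\<^sub>E U. \<omega> f * (\<Sum>k<n. 2 * \<sigma> k * (\<tau> f (c k) * \<tau> f (c (s k)))))"
    unfolding sum_distrib_left by (rule sum.swap)
  also have "\<dots> \<le> (\<Sum>f\<in>Q \<rightarrow>\<^sub>E U. \<omega> f * (\<Sum>k<n. (\<tau> f (c k))\<^sup>2))"
  proof (rule sum_mono)
    fix f assume f: "f \<in> Q \<rightarrow>\<^sub>E U"
    have "(\<Sum>k<n. 2 * \<sigma> k * (\<tau> f (c k) * \<tau> f (c (s k)))) \<le> (\<Sum>k<n. (\<tau> f (c k))\<^sup>2)"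
      unfolding s_def
    proof (rule cycle_clique_vector[OF n])
      show "\<bar>\<sigma> k\<bar> = 1" for k by (simp add: \<sigma>_def)
    qed (use \<tau>0[OF f] in \<open>simp add: s_def\<close>)
    then show "\<omega> f * (\<Sum>k<n. 2 * \<sigma> k * (\<tau> f (c k) * \<tau> f (c (s k)))) \<le> \<omega> f * (\<Sum>k<n. (\<tau> f (c k))\<^sup>2)"
      using \<omega>[OF f] by (rule mult_left_mono)
  qed
  also have "\<dots> = (\<Sum>k<n. \<Sum>f\<in>Q \<rightarrow>\<^sub>E U. \<omega> f * (\<tau> f (c k) * \<tau> f (c k)))"
    unfolding sum_distrib_left power2_eq_square by (rule sum.swap)
  also have "\<dots> = (\<Sum>k<n. K * (2 - e))"
    using Wd by (intro sum.cong) (auto simp: KW[OF cC cC, symmetric])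
  also have "\<dots> = 2 * real n * K - real n * K * e" by (simp add: algebra_simps)
  finally have "real n * K * e \<le> 0" by simp
  moreover have "real n * K * e > 0" using n K e by simp
  ultimately show False by simp
qed

theorem theorem1p3:
  fixes V :: "('a::infinite) set" and D B :: "('a \<times> 'a) set"
  assumes "chain_graph V D B"
  shows "strictly_gaussian_causal V D B \<longleftrightarrow> decomposable V B"
  using strictly_gaussian_causal_imp_decomposable[OF assms] decomposable_imp_strictly_gaussian_causal[OF assms]
  by blast

end
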